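(* Let $n\ge 3$ and let $G=(V,E)$ be the complete undirected graph on $n$ nodes with edge costs $c(e)\in\{1,2\}$ for all $e\in E$. Let $x$ be a fractional 2-matching (F2M) that is connected, i.e., its support graph $(V,\{e: x(e)>0\})$ is connected. Then there exists a tour (Hamiltonian cycle) in $G$ of cost at most $\frac76\sum_{e\in E}c(e)x(e)$.
   Context: A fractional 2-matching (F2M) is an extreme point of the polytope $\{x\in\mathbb{R}^E: \sum_{e\in\delta(i)}x(e)=2\ \forall i\in V,\ 0\le x(e)\le 1\ \forall e\in E\}$, where $\delta(i)$ is the set of edges incident to node $i$. Its cost is $\sum_{e\in E}c(e)x(e)$. *)

theory Defs
  imports "HOL-Analysis.Analysis"
begin

text \<open>The node set is the universe of a finite type \<open>'v\<close>; edges are two-element sets of nodes.\<close>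

definition complete_edges :: "'v set set" where
  "complete_edges = {e. card e = 2}"

definition incident_edges :: "'v \<Rightarrow> 'v set set" where
  "incident_edges i = {e \<in> complete_edges. i \<in> e}"

text \<open>A vector indexed by edges is a vector indexed by all node sets whose coordinates
  outside the edge set vanish. This is a linear copy of the space of edge-indexed vectors,
  so extreme points are the same in both.\<close>

definition two_matching_polytope :: "(real ^ ('v::finite set)) set" where
  "two_matching_polytope = {x.
     (\<forall>i. (\<Sum>e\<in>incident_edges i. x $ e) = 2) \<and>
     (\<forall>e\<in>complete_edges. 0 \<le> x $ e \<and> x $ e \<le> 1) \<and>
     (\<forall>e. e \<notin> complete_edges \<longrightarrow> x $ e = 0)}"

definition fractional_2_matching :: "real ^ ('v::finite set) \<Rightarrow> bool" where
  "fractional_2_matching x \<longleftrightarrow> x extreme_point_of two_matching_polytope"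

definition support_edges :: "real ^ ('v::finite set) \<Rightarrow> 'v set set" where
  "support_edges x = {e \<in> complete_edges. x $ e > 0}"

definition connected_graph :: "'v set set \<Rightarrow> bool" where
  "connected_graph F \<longleftrightarrow> (\<forall>u v. (u, v) \<in> {(a, b). {a, b} \<in> F}\<^sup>*)"

definition cycle_edges :: "'v list \<Rightarrow> 'v set set" where
  "cycle_edges vs = {{vs ! i, vs ! (Suc i mod length vs)} | i. i < length vs}"

text \<open>A tour is the edge set of a Hamiltonian cycle. With fewer than three nodes,
  the edges listed by \<open>cycle_edges\<close> would not form a cycle.\<close>

definition tour :: "'v set set \<Rightarrow> bool" where
  "tour T \<longleftrightarrow>
     (\<exists>vs. distinct vs \<and> set vs = UNIV \<and> 3 \<le> length vs \<and> T = cycle_edges vs)"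

end

theory Submission
  imports Defs
begin

text \<open>The fractional edges of an extreme point are linearly independent, which forces them to form
  disjoint odd cycles of edges of value 1/2 on a node set \<open>U\<close>; every node of \<open>U\<close> has one edge of
  value 1 and every other node has two. Let \<open>M\<close> be the cost-1 edges of value 1 and \<open>A\<close> the
  cost-1 edges of value 1/2. For a matching \<open>N\<close> of edges in \<open>A\<close>, the graph \<open>M \<union> N\<close> consists of
  paths and cycles, and joining these by arbitrary edges gives a tour of cost at most the number of
  nodes plus the number of components.

  Choose \<open>N\<close> with the fewest components and, among those, with the most edges. Call a node of
  \<open>U\<close> missed by \<open>N\<close> a hole, and an edge of \<open>N\<close> on a cycle of \<open>M \<union> N\<close> a cycle edge. Along an odd
  cycle, exchanging edges shows that holes and cycle edges are separated by other edges of \<open>N\<close> or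
  by edges of cost 2: two holes are not adjacent, nor are a hole and a cycle edge; moreover two
  edges of different cycles cannot be separated by holes and edges that alternate perfectly. The last
  point holds because a hole can be shifted into a cycle, which keeps \<open>N\<close> optimal and shortens
  the alternating stretch. With this spacing, a discharging argument along the odd cycles bounds
  the number of cycles, hence of components.\<close>

section \<open>Components and Hamiltonian paths\<close>

text \<open>With n nodes, h holes and w half edges of cost 2, the tour is cheap enough once the
  cycles of \<open>M \<union> N\<close> number at most n/6 - h/2 + 7w/12: a half edge of cost 2 adds
  1/2 to the fractional cost compared with one of cost 1, and 7/6 of that is 7/12. The obstacle is a
  cycle with a single edge in \<open>N\<close>. A node outside \<open>U\<close> on it gives 1/6, so
  5/6 must be saved up along the odd cycle, where an edge earns 1/3 and a hole loses 1/3. Behind a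
  cycle edge, a stretch in which edges and holes alternate may hold no more than 1/3; with the 1/3
  of the next cycle edge this is only 2/3. Such stretches can be long, which is why the hole is
  shifted step by step until one fixed exchange applies. When the stretch runs around a whole odd
  cycle back to its own start, there is no second cycle to join; there oddness leaves only a
  heptagon and longer cycles with at least three holes to refute. Connectivity serves to exclude
  cycles inside \<open>M\<close>, which contain no edge of \<open>N\<close> that could pay for
  them.\<close>

definition linked :: "'v set set \<Rightarrow> 'v \<Rightarrow> 'v \<Rightarrow> bool" where
  "linked F u v \<longleftrightarrow> (u, v) \<in> {(a, b). {a, b} \<in> F}\<^sup>*"

definition component :: "'v set set \<Rightarrow> 'v \<Rightarrow> 'v set" where
  "component F v = {u. linked F v u}"

definition num_components :: "'v set set \<Rightarrow> nat" where
  "num_components F = card (range (component F))"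

definition valency :: "'v set set \<Rightarrow> 'v \<Rightarrow> nat" where
  "valency F v = card {e \<in> F. v \<in> e}"

lemma linked_refl [simp]: "linked F u u"
  by (simp add: linked_def)

lemma linked_sym: "linked F u v \<Longrightarrow> linked F v u"
proof -
  have "sym {(a, b). {a, b} \<in> F}"
    by (auto simp: sym_def insert_commute)
  then show "linked F u v \<Longrightarrow> linked F v u"
    unfolding linked_def by (meson symE sym_rtrancl)
qed

lemma linked_trans: "linked F u v \<Longrightarrow> linked F v w \<Longrightarrow> linked F u w"
  by (auto simp: linked_def)

lemma linked_edge: "{u, v} \<in> F \<Longrightarrow> linked F u v"
  by (auto simp: linked_def)

lemma linked_mono:
  assumes "linked F u v" "F \<subseteq> F'"
  shows "linked F' u v"
proof -
  have "{(a, b). {a, b} \<in> F} \<subseteq> {(a, b). {a, b} \<in> F'}" using assms(2) by auto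
  then show ?thesis using assms(1) rtrancl_mono unfolding linked_def by blast
qed

lemma linked_iff: "linked F u v \<longleftrightarrow> component F u = component F v"
  unfolding component_def using linked_refl linked_sym linked_trans
  by (metis (no_types, lifting) Collect_cong mem_Collect_eq)

lemma mem_component: "u \<in> component F v \<longleftrightarrow> component F u = component F v"
  using linked_iff linked_sym by (metis component_def mem_Collect_eq)

text \<open>A walk along the enlarged graph can be shortened until it uses the new edge at most
  once, in one of the two directions.\<close>

lemma linked_insert:
  "linked (insert {u, w} G) x y \<longleftrightarrow>
     component G x = component G y \<or>
     component G x = component G u \<and> component G w = component G y \<or>
     component G x = component G w \<and> component G u = component G y" (is "_ \<longleftrightarrow> ?R x y")
proof
  assume "linked (insert {u, w} G) x y"
  then have "(x, y) \<in> {(a, b). {a, b} \<in> insert {u, w} G}\<^sup>*"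
    by (simp add: linked_def)
  then show "?R x y"
  proof induction
    case base
    then show ?case by simp
  next
    case (step y z)
    then have "{y, z} = {u, w} \<or> component G y = component G z"
      using linked_edge linked_iff by fastforce
    then have "y = u \<and> z = w \<or> y = w \<and> z = u \<or> component G y = component G z"
      by (auto simp: doubleton_eq_iff)
    then show ?case using step.IH by (elim disjE conjE) simp_all
  qed
next
  have *: "linked (insert {u, w} G) a b" if "component G a = component G b" for a b
    using that linked_iff linked_mono subset_insertI by metis
  have "linked (insert {u, w} G) u w" by (simp add: linked_edge)
  then show "?R x y \<Longrightarrow> linked (insert {u, w} G) x y"
    using * linked_sym linked_trans by metis
qed

lemma component_insert:
  "component (insert {u, w} G) x =
     (if component G x \<in> {component G u, component G w}
      then component G u \<union> component G w else component G x)"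
proof (rule set_eqI)
  fix y
  have "y \<in> component (insert {u, w} G) x \<longleftrightarrow> linked (insert {u, w} G) x y"
    by (simp add: component_def)
  also have "\<dots> \<longleftrightarrow> y \<in> (if component G x \<in> {component G u, component G w}
      then component G u \<union> component G w else component G x)"
    unfolding linked_insert by (simp add: mem_component) metis
  finally show "y \<in> component (insert {u, w} G) x \<longleftrightarrow> y \<in> (if component G x \<in> {component G u, component G w}
      then component G u \<union> component G w else component G x)" .
qed

text \<open>Written as an equation for the smaller graph, so that it serves for insertion and for
  deletion without subtraction on naturals.\<close>

lemma num_components_insert:
  fixes G :: "'v::finite set set"
  shows "num_components G = num_components (insert {u, w} G) +
           (if component G u = component G w then 0 else 1)"
proof (cases "component G u = component G w")
  case True
  then have "component (insert {u, w} G) = component G"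
    by (auto simp: component_insert fun_eq_iff)
  then show ?thesis using True by (simp add: num_components_def)
next
  case False
  let ?R = "range (component G)" and ?u = "component G u" and ?w = "component G w"
  have u: "u \<in> ?u" and w: "w \<in> ?w" by (simp_all add: mem_component)
  have "range (component (insert {u, w} G)) = insert (?u \<union> ?w) (?R - {?u, ?w})"
    by (auto simp: component_insert image_iff split: if_splits)
  moreover have "?u \<union> ?w \<notin> ?R - {?u, ?w}"
  proof
    assume "?u \<union> ?w \<in> ?R - {?u, ?w}"
    then obtain z where z: "?u \<union> ?w = component G z" by auto
    then have "u \<in> component G z" "w \<in> component G z" using u w by blast+
    then show False using False by (simp add: mem_component)
  qed
  ultimately have "num_components (insert {u, w} G) = Suc (card (?R - {?u, ?w}))"
    by (simp add: num_components_def)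
  moreover have "card (?R - {?u, ?w}) = card ?R - 2"
    using False by (subst card_Diff_subset) auto
  moreover have "card {?u, ?w} \<le> card ?R"
    by (intro card_mono) auto
  ultimately show ?thesis using False by (simp add: num_components_def)
qed

section \<open>Valency sums and Hamiltonian paths of components\<close>

text \<open>The second hypothesis makes \<open>D\<close> closed under edges, so an edge contributes
  either 2 or 0 to the sum.\<close>

lemma handshake:
  fixes F :: "'v::finite set set"
  assumes "\<And>e. e \<in> F \<Longrightarrow> card e = 2" and "\<And>e. e \<in> F \<Longrightarrow> e \<inter> D \<noteq> {} \<Longrightarrow> e \<subseteq> D"
  shows "(\<Sum>v\<in>D. valency F v) = 2 * card {e \<in> F. e \<subseteq> D}"
proof -
  have "(\<Sum>v\<in>D. valency F v) = (\<Sum>v\<in>D. \<Sum>e\<in>F. if v \<in> e then 1 else 0)"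
    by (simp add: valency_def sum.If_cases Int_def)
  also have "\<dots> = (\<Sum>e\<in>F. \<Sum>v\<in>D. if v \<in> e then 1 else 0)"
    by (rule sum.swap)
  also have "\<dots> = (\<Sum>e\<in>F. if e \<subseteq> D then 2 else 0)"
  proof (rule sum.cong)
    fix e assume e: "e \<in> F"
    have "(\<Sum>v\<in>D. if v \<in> e then 1 else 0) = card (D \<inter> e)"
      by (simp add: sum.If_cases)
    moreover have "e \<noteq> {}" using assms(1)[OF e] by auto
    ultimately show "(\<Sum>v\<in>D. if v \<in> e then 1 else 0) = (if e \<subseteq> D then 2 else (0::nat))"
      using assms[OF e] by (auto simp: Int_absorb1 Int_commute)
  qed simp
  also have "\<dots> = 2 * card {e \<in> F. e \<subseteq> D}"
    by (simp add: sum.If_cases Int_def)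
  finally show ?thesis .
qed

lemma component_closed:
  assumes "\<And>e. e \<in> F \<Longrightarrow> card e = 2" "e \<in> F" "e \<inter> component F v \<noteq> {}"
  shows "e \<subseteq> component F v"
proof -
  obtain a b where ab: "e = {a, b}" using assms(1,2) by (meson card_2_iff)
  then have "component F a = component F b"
    using assms(2) linked_edge linked_iff by metis
  then show ?thesis using assms(3) ab by (auto simp: mem_component)
qed

definition walk :: "'v set set \<Rightarrow> 'v list \<Rightarrow> bool" where
  "walk F vs \<longleftrightarrow> distinct vs \<and> (\<forall>i. Suc i < length vs \<longrightarrow> {vs ! i, vs ! Suc i} \<in> F)"

lemma three_neighbours:
  fixes F :: "'v::finite set set"
  assumes "{v, a} \<in> F" "{v, b} \<in> F" "{v, c} \<in> F" "a \<noteq> b" "a \<noteq> c" "b \<noteq> c"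
  shows "3 \<le> valency F v"
proof -
  have "{{v, a}, {v, b}, {v, c}} \<subseteq> {e \<in> F. v \<in> e}" using assms by auto
  then have "card {{v, a}, {v, b}, {v, c}} \<le> valency F v"
    unfolding valency_def by (intro card_mono) auto
  moreover have "card {{v, a}, {v, b}, {v, c}} = 3"
    using assms by (auto simp: doubleton_eq_iff card_insert_if)
  ultimately show ?thesis by simp
qed

lemma two_neighbours:
  fixes F :: "'v::finite set set"
  assumes "{v, a} \<in> F" "{v, b} \<in> F" "a \<noteq> b"
  shows "2 \<le> valency F v"
proof -
  have "{{v, a}, {v, b}} \<subseteq> {e \<in> F. v \<in> e}" using assms by auto
  then have "card {{v, a}, {v, b}} \<le> valency F v"
    unfolding valency_def by (intro card_mono) auto
  then show ?thesis using assms by (auto simp: doubleton_eq_iff)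
qed

lemma walk_neighbour:
  fixes F :: "'v::finite set set"
  assumes "walk F vs" "\<And>v. valency F v \<le> 2" "i < length vs" "{vs ! i, y} \<in> F"
    "0 < i" "Suc i < length vs"
  shows "y = vs ! (i - 1) \<or> y = vs ! Suc i"
proof (rule ccontr)
  assume "\<not> ?thesis"
  moreover have "{vs ! i, vs ! (i - 1)} \<in> F"
    using assms unfolding walk_def by (metis Suc_pred' insert_commute)
  moreover have "{vs ! i, vs ! Suc i} \<in> F" using assms unfolding walk_def by blast
  moreover have "vs ! (i - 1) \<noteq> vs ! Suc i"
    using assms unfolding walk_def by (simp add: nth_eq_iff_index_eq)
  ultimately have "3 \<le> valency F (vs ! i)"
    using three_neighbours assms(4) by metis
  then show False using assms(2)[of "vs ! i"] by simp
qed

text \<open>A longest path inside a component cannot be left: its inner nodes have no further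
  neighbours, and at its ends it could be extended.\<close>

lemma component_hamiltonian_path:
  fixes F :: "'v::finite set set"
  assumes edges: "\<And>e. e \<in> F \<Longrightarrow> card e = 2" and deg: "\<And>v. valency F v \<le> 2"
  obtains vs where "walk F vs" "set vs = component F v" "vs \<noteq> []"
proof -
  let ?P = "\<lambda>vs. walk F vs \<and> set vs \<subseteq> component F v \<and> vs \<noteq> []"
  have "?P [v]" by (simp add: walk_def mem_component)
  moreover have "\<forall>vs. ?P vs \<longrightarrow> length vs < Suc CARD('v)"
    unfolding less_Suc_eq_le by (metis card_mono distinct_card finite top_greatest walk_def)
  ultimately obtain vs where vs: "?P vs" and max: "\<And>ws. ?P ws \<Longrightarrow> length ws \<le> length vs"
    using ex_has_greatest_nat[of ?P "[v]" length "Suc CARD('v)"] by blast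
  have closed: "y \<in> set vs" if "x \<in> set vs" "{x, y} \<in> F" for x y
  proof (rule ccontr)
    assume y: "y \<notin> set vs"
    obtain i where i: "i < length vs" "x = vs ! i" using \<open>x \<in> set vs\<close> by (metis in_set_conv_nth)
    have yc: "y \<in> component F v"
      using that vs linked_edge[OF that(2)] by (auto simp: linked_iff mem_component)
    consider "i = 0" | "0 < i" "Suc i < length vs" | "Suc i = length vs" using i by linarith
    then show False
    proof cases
      case 1
      have "walk F (y # vs)"
        unfolding walk_def
      proof (intro conjI allI impI)
        fix j assume j: "Suc j < length (y # vs)"
        show "{(y # vs) ! j, (y # vs) ! Suc j} \<in> F"
        proof (cases j)
          case 0
          then show ?thesis using 1 i that by (simp add: insert_commute)
        next
          case (Suc k)
          then show ?thesis using j vs by (simp add: walk_def)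
        qed
      qed (use vs y in \<open>auto simp: walk_def\<close>)
      then have "?P (y # vs)" using vs yc by auto
      then show False using max by fastforce
    next
      case 2
      then have "y = vs ! (i - 1) \<or> y = vs ! Suc i"
        using walk_neighbour[of F vs i y] vs deg i that by blast
      then show False using y 2 by auto
    next
      case 3
      have "walk F (vs @ [y])"
        unfolding walk_def
      proof (intro conjI allI impI)
        fix j assume j: "Suc j < length (vs @ [y])"
        show "{(vs @ [y]) ! j, (vs @ [y]) ! Suc j} \<in> F"
        proof (cases "Suc j = length vs")
          case True
          then have "j = i" using 3 by simp
          then show ?thesis using i that by (simp add: nth_append 3[symmetric])
        next
          case False
          then show ?thesis using j vs by (simp add: walk_def nth_append)
        qed
      qed (use vs y in \<open>auto simp: walk_def\<close>)
      then have "?P (vs @ [y])" using vs yc by auto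
      then show False using max by fastforce
    qed
  qed
  have "component F v \<subseteq> set vs"
  proof
    fix u assume "u \<in> component F v"
    moreover have hd: "hd vs \<in> set vs" using vs by simp
    ultimately have "linked F (hd vs) u"
      using vs by (metis linked_iff mem_component subsetD)
    then have "(hd vs, u) \<in> {(a, b). {a, b} \<in> F}\<^sup>*" by (simp add: linked_def)
    then show "u \<in> set vs"
      by induction (use hd closed in auto)
  qed
  then show thesis using that vs by blast
qed

lemma walk_inner_valency:
  fixes F :: "'v::finite set set"
  assumes "walk F vs" "0 < i" "Suc i < length vs"
  shows "2 \<le> valency F (vs ! i)"
proof (rule two_neighbours)
  show "{vs ! i, vs ! (i - 1)} \<in> F"
    using assms unfolding walk_def by (metis Suc_lessD Suc_pred' insert_commute)
  show "{vs ! i, vs ! Suc i} \<in> F" using assms unfolding walk_def by blast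
  show "vs ! (i - 1) \<noteq> vs ! Suc i"
    using assms unfolding walk_def by (simp add: nth_eq_iff_index_eq)
qed

text \<open>On a Hamiltonian path of the component the inner nodes already have two neighbours, so
  nodes of valency at most 1 sit at its two ends.\<close>

lemma at_most_two_ends:
  fixes F :: "'v::finite set set"
  assumes edges: "\<And>e. e \<in> F \<Longrightarrow> card e = 2" and deg: "\<And>v. valency F v \<le> 2"
    and "valency F a \<le> 1" "valency F b \<le> 1" "valency F c \<le> 1"
    and "component F a = component F b" "component F a = component F c"
  shows "a = b \<or> a = c \<or> b = c"
proof -
  obtain vs where vs: "walk F vs" "set vs = component F a"
    using component_hamiltonian_path[OF edges deg] by metis
  have ends: "x = vs ! 0 \<or> x = vs ! (length vs - 1)"
    if "valency F x \<le> 1" "component F x = component F a" for x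
  proof -
    have "x \<in> set vs" using vs that by (simp add: mem_component)
    then obtain i where i: "i < length vs" "x = vs ! i" by (metis in_set_conv_nth)
    then have "\<not> (0 < i \<and> Suc i < length vs)"
      using walk_inner_valency[OF vs(1), of i] that(1) by auto
    then have "i = 0 \<or> i = length vs - 1" using i by linarith
    then show ?thesis using i by auto
  qed
  show ?thesis using ends[of a] ends[of b] ends[of c] assms by metis
qed

text \<open>Both neighbours of the first node lie on the path. An inner node beyond the second one
  has its two neighbours on the path next to it, so the first node can only be joined to the second
  and to the last node.\<close>

lemma walk_closes:
  fixes F :: "'v::finite set set"
  assumes edges: "\<And>e. e \<in> F \<Longrightarrow> card e = 2" and deg: "\<And>v. valency F v \<le> 2"
    and "walk F vs" "set vs = component F v" "\<And>u. u \<in> set vs \<Longrightarrow> valency F u = 2"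
    and "vs \<noteq> []"
  shows "3 \<le> length vs \<and> {vs ! (length vs - 1), vs ! 0} \<in> F"
proof -
  let ?h = "vs ! 0"
  have h: "?h \<in> set vs" using assms(6) by (intro nth_mem) simp
  then have "card {e \<in> F. ?h \<in> e} = 2" using assms(5) by (simp add: valency_def)
  then obtain e f where ef: "e \<in> F" "f \<in> F" "?h \<in> e" "?h \<in> f" "e \<noteq> f"
    unfolding card_2_iff by blast
  obtain y z where yz: "e = {?h, y}" "f = {?h, z}" "y \<noteq> ?h" "z \<noteq> ?h"
    using edges[OF ef(1)] edges[OF ef(2)] ef(3,4) unfolding card_2_iff
    by (metis doubleton_eq_iff empty_iff insert_iff)
  then have "y \<noteq> z" using ef(5) by blast
  have inside: "w \<in> set vs" if "{?h, w} \<in> F" for w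
    using linked_edge[OF that] h assms(4) by (auto simp: linked_iff mem_component)
  have pos: "w = vs ! 1 \<or> w = vs ! (length vs - 1)" if w: "{?h, w} \<in> F" "w \<noteq> ?h" for w
  proof -
    obtain i where i: "i < length vs" "w = vs ! i" using inside[OF w(1)] by (metis in_set_conv_nth)
    have "i \<noteq> 0" using i w(2) by metis
    have "i = 1 \<or> Suc i = length vs"
    proof (rule ccontr)
      assume n: "\<not> ?thesis"
      then have "1 < i" "Suc i < length vs" using i \<open>i \<noteq> 0\<close> by linarith+
      moreover have "{vs ! i, ?h} \<in> F" using w(1) i by (simp add: insert_commute)
      ultimately have "?h = vs ! (i - 1) \<or> ?h = vs ! Suc i"
        using walk_neighbour[of F vs i ?h] assms(3) deg i by simp
      then show False
        using \<open>1 < i\<close> \<open>Suc i < length vs\<close> assms(3,6) less_imp_diff_less[OF i(1), of "Suc 0"]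
          nth_eq_iff_index_eq[of vs 0 "i - 1"] nth_eq_iff_index_eq[of vs 0 "Suc i"]
        by (auto simp: walk_def)
    qed
    then have "i = 1 \<or> i = length vs - 1" by linarith
    then show ?thesis using i(2) by blast
  qed
  have *: "vs ! 1 \<noteq> vs ! (length vs - 1)" "{?h, vs ! (length vs - 1)} \<in> F"
    using pos[of y] pos[of z] ef yz \<open>y \<noteq> z\<close> by metis+
  have "vs ! (length vs - 1) \<noteq> ?h"
    using pos[of y] pos[of z] ef yz \<open>y \<noteq> z\<close> by metis
  then have "length vs \<noteq> 1" by auto
  moreover have "length vs \<noteq> 2" using *(1) by auto
  moreover have "length vs \<noteq> 0" using assms by simp
  ultimately have "3 \<le> length vs" by linarith
  then show ?thesis using * by (simp add: insert_commute)
qed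

text \<open>Parity: if the edge were a bridge, deleting it would leave \<open>a\<close> in a
  component in which \<open>a\<close> has valency 1 and all others have valency 2, an odd
  sum.\<close>

lemma cyclic_component_edge_not_bridge:
  fixes F :: "'v::finite set set"
  assumes edges: "\<And>e. e \<in> F \<Longrightarrow> card e = 2"
    and two: "\<And>u. u \<in> component F a \<Longrightarrow> valency F u = 2" and ab: "{a, b} \<in> F" "a \<noteq> b"
  shows "component (F - {{a, b}}) a = component (F - {{a, b}}) b"
proof (rule ccontr)
  assume ne: "component (F - {{a, b}}) a \<noteq> component (F - {{a, b}}) b"
  let ?G = "F - {{a, b}}"
  let ?D = "component ?G a"
  have sub: "?D \<subseteq> component F a"
    unfolding component_def using linked_mono[of ?G] by auto
  have b: "b \<notin> ?D" using ne by (metis mem_component)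
  have degs: "valency ?G u = (if u = a then 1 else 2)" if "u \<in> ?D" for u
  proof -
    have "{e \<in> ?G. u \<in> e} = {e \<in> F. u \<in> e} - {{a, b}}" by auto
    moreover have "card {e \<in> F. u \<in> e} = 2" using two sub that by (auto simp: valency_def)
    moreover have "u \<noteq> b" using b that by auto
    then have "{a, b} \<in> {e \<in> F. u \<in> e} \<longleftrightarrow> u = a" using ab by simp
    ultimately show ?thesis unfolding valency_def by (simp only: card_Diff_singleton_if) simp
  qed
  have "(\<Sum>v\<in>?D. valency ?G v) = 2 * card {e \<in> ?G. e \<subseteq> ?D}"
    using edges component_closed[of ?G] by (intro handshake) auto
  moreover have a: "a \<in> ?D" by (simp add: mem_component)
  moreover have "(\<Sum>v\<in>?D. valency ?G v) = 1 + 2 * card (?D - {a})"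
    using a degs by (subst sum.remove[OF _ a]) auto
  ultimately show False by presburger
qed

section \<open>Tours from graphs of maximum valency two\<close>

fun breaks :: "'v set set \<Rightarrow> 'v list \<Rightarrow> nat" where
  "breaks F [] = 0"
| "breaks F [x] = 0"
| "breaks F (x # y # zs) = (if {x, y} \<in> F then 0 else 1) + breaks F (y # zs)"

lemma breaks_append: "breaks F (xs @ ys) \<le> breaks F xs + breaks F ys + 1"
proof (induction F xs rule: breaks.induct)
  case (2 F x)
  then show ?case by (cases ys) auto
qed auto

lemma breaks_walk: "walk F vs \<Longrightarrow> breaks F vs = 0"
proof (induction F vs rule: breaks.induct)
  case (3 F x y zs)
  have "walk F (y # zs)"
    using 3(2) unfolding walk_def by (metis distinct.simps(2) length_Cons nth_Cons_Suc Suc_less_eq)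
  moreover have "{x, y} \<in> F" using 3(2) unfolding walk_def by force
  ultimately show ?case using 3 by simp
qed auto

lemma path_cost_le:
  fixes c :: "'v set \<Rightarrow> real"
  assumes "\<And>e. e \<in> F \<Longrightarrow> c e = 1" "\<And>e. card e = 2 \<Longrightarrow> c e \<in> {1, 2}" "distinct vs" "vs \<noteq> []"
  shows "(\<Sum>i<length vs - 1. c {vs ! i, vs ! Suc i}) \<le> real (length vs - 1) + real (breaks F vs)"
  using assms
proof (induction F vs rule: breaks.induct)
  case (3 F x y zs)
  have "(\<Sum>i<length (y # zs) - 1. c {(y # zs) ! i, (y # zs) ! Suc i})
      \<le> real (length (y # zs) - 1) + real (breaks F (y # zs))"
    using 3 by simp
  moreover have "c {x, y} \<le> 2" using 3(3)[of "{x, y}"] 3(4) by auto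
  moreover have "c {x, y} = 1" if "{x, y} \<in> F" using 3(2) that by simp
  ultimately show ?case by (simp add: sum.lessThan_Suc_shift del: sum.lessThan_Suc)
qed auto

text \<open>Each component has a Hamiltonian path without breaks, and appending one more path
  creates at most one break.\<close>

lemma components_concat:
  fixes F :: "'v::finite set set"
  assumes "\<And>e. e \<in> F \<Longrightarrow> card e = 2" "\<And>v. valency F v \<le> 2"
    and "finite D" "D \<noteq> {}" "D \<subseteq> range (component F)"
  shows "\<exists>vs. distinct vs \<and> set vs = \<Union>D \<and> Suc (breaks F vs) \<le> card D"
  using assms(3-5)
proof (induction rule: finite_ne_induct)
  case (singleton d)
  then obtain v where "d = component F v" by auto
  then obtain vs where "walk F vs" "set vs = d"
    using component_hamiltonian_path[OF assms(1,2)] by metis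
  then show ?case by (intro exI[of _ vs]) (auto simp: breaks_walk walk_def)
next
  case (insert d D)
  then obtain ws where ws: "distinct ws" "set ws = \<Union>D" "Suc (breaks F ws) \<le> card D" by auto
  from insert obtain v where v: "d = component F v" by auto
  then obtain vs where vs: "walk F vs" "set vs = d"
    using component_hamiltonian_path[OF assms(1,2)] by metis
  have "d \<inter> d' = {}" if d': "d' \<in> D" for d'
  proof -
    obtain w where "d' = component F w" "d' \<noteq> d" using d' insert by blast
    then show ?thesis using v by (auto simp: mem_component)
  qed
  then have "set vs \<inter> set ws = {}" using ws vs by auto
  moreover have "breaks F (vs @ ws) \<le> breaks F ws + 1"
    using breaks_append[of F vs ws] breaks_walk[OF vs(1)] by simp
  ultimately show ?case
    using ws vs insert by (intro exI[of _ "vs @ ws"]) (auto simp: walk_def)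
qed

text \<open>For n nodes and k components, the concatenated paths cost at most (n - 1) + (k - 1), and
  the closing edge at most 2, which gives n + k.\<close>

lemma tour_from_components:
  fixes F :: "'v::finite set set" and c :: "'v set \<Rightarrow> real"
  assumes "3 \<le> CARD('v)" "\<And>e. e \<in> F \<Longrightarrow> card e = 2" "\<And>v. valency F v \<le> 2"
    and "\<And>e. e \<in> F \<Longrightarrow> c e = 1" "\<And>e. card e = 2 \<Longrightarrow> c e \<in> {1, 2}"
  shows "\<exists>T. tour T \<and> (\<Sum>e\<in>T. c e) \<le> real (CARD('v) + num_components F)"
proof -
  obtain vs where vs: "distinct vs" "set vs = \<Union>(range (component F))"
      "Suc (breaks F vs) \<le> num_components F"
    using components_concat[OF assms(2,3), of "range (component F)"]
    by (auto simp: num_components_def)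
  have set: "set vs = UNIV" using vs(2) by (auto simp: mem_component)
  then have len: "length vs = CARD('v)" using vs(1) by (metis distinct_card)
  let ?L = "length vs"
  let ?f = "\<lambda>i. {vs ! i, vs ! (Suc i mod ?L)}"
  have T: "cycle_edges vs = ?f ` {..<?L}" by (auto simp: cycle_edges_def)
  have two: "card (?f i) = 2" if "i < ?L" for i
  proof -
    have "Suc i mod ?L < ?L" "Suc i mod ?L \<noteq> i"
      using that len assms(1) by (auto simp: mod_Suc)
    then show ?thesis using that vs(1) by (simp add: nth_eq_iff_index_eq)
  qed
  have pos: "0 \<le> c (?f i)" "c (?f i) \<le> 2" if "i < ?L" for i
    using assms(5)[OF two[OF that]] by auto
  have "?L \<noteq> 0" using len assms(1) by simp
  then obtain m where m: "?L = Suc m" using not0_implies_Suc by blast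
  \<comment> \<open>Costs are nonnegative, so the sum over the set of edges is at most the sum over
    positions, whether or not positions share an edge.\<close>
  have "(\<Sum>e\<in>cycle_edges vs. c e) \<le> (\<Sum>i<?L. c (?f i))"
    unfolding T using pos by (intro sum_image_le[THEN order_trans]) auto
  also have "\<dots> = (\<Sum>i<m. c (?f i)) + c (?f m)"
    by (simp add: m)
  also have "(\<Sum>i<m. c (?f i)) = (\<Sum>i<?L - 1. c {vs ! i, vs ! Suc i})"
    by (rule sum.cong) (auto simp: m)
  also have "\<dots> + c (?f m) \<le> real (?L - 1) + real (breaks F vs) + 2"
    using path_cost_le[OF assms(4,5) vs(1), of F] pos[of m] m by fastforce
  also have "\<dots> \<le> real (CARD('v) + num_components F)"
    using vs(3) len m by simp
  finally show ?thesis
    using vs(1) set len assms(1) unfolding tour_def by (intro exI[of _ "cycle_edges vs"]) auto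
qed

text \<open>This settles the case in which the 2-matching has no fractional edges.\<close>

lemma connected_two_regular_tour:
  fixes F :: "'v::finite set set"
  assumes "\<And>e. e \<in> F \<Longrightarrow> card e = 2" "\<And>v. valency F v = 2" "connected_graph F"
  shows "\<exists>T. tour T \<and> T \<subseteq> F"
proof -
  have deg: "valency F v \<le> 2" for v using assms(2) by simp
  fix v :: 'v
  obtain vs where vs: "walk F vs" "set vs = component F v" "vs \<noteq> []"
    using component_hamiltonian_path[OF assms(1) deg] by metis
  have "component F v = UNIV"
    using assms(3) by (auto simp: component_def linked_def connected_graph_def)
  then have set: "set vs = UNIV" using vs by simp
  have close: "3 \<le> length vs" "{vs ! (length vs - 1), vs ! 0} \<in> F"
    using walk_closes[OF assms(1) deg vs(1,2) assms(2) vs(3)] by auto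
  have "{vs ! i, vs ! (Suc i mod length vs)} \<in> F" if "i < length vs" for i
  proof (cases "Suc i = length vs")
    case True
    then have "i = length vs - 1" by simp
    then show ?thesis using close True by simp
  next
    case False
    then show ?thesis using vs(1) that by (auto simp: walk_def)
  qed
  then have "cycle_edges vs \<subseteq> F" by (auto simp: cycle_edges_def)
  then show ?thesis using vs(1) set close unfolding tour_def walk_def by blast
qed

section \<open>Optimal choices of half edges\<close>

text \<open>All exchange arguments below follow one scheme: the edges concerned are stripped from
  \<open>N\<close>, every graph in question is written as a series of insertions into the rest, and
  equalities of components are reduced to equalities in the stripped graph. The changes in number
  then follow from \<open>num_components_insert\<close>.\<close>

lemma component_insert_eq:
  "component (insert {u, w} G) x = component (insert {u, w} G) y \<longleftrightarrow>
     component G x = component G y \<or>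
     component G x = component G u \<and> component G w = component G y \<or>
     component G x = component G w \<and> component G u = component G y"
  using linked_insert by (simp add: linked_iff)

lemma component_mono_eq:
  "component G x = component G y \<Longrightarrow> G \<subseteq> F \<Longrightarrow> component F x = component F y"
  using linked_mono by (metis linked_iff)

locale half_edge_graph =
  fixes M A :: "'v::finite set set" and U :: "'v set"
  assumes M_edge: "e \<in> M \<Longrightarrow> card e = 2"
    and A_edge: "e \<in> A \<Longrightarrow> card e = 2"
    and A_sub: "e \<in> A \<Longrightarrow> e \<subseteq> U"
    and M_valency: "valency M v \<le> 2"
    and M_valency_U: "v \<in> U \<Longrightarrow> valency M v \<le> 1"
begin

definition admissible :: "'v set set \<Rightarrow> bool" where
  "admissible N \<longleftrightarrow> N \<subseteq> A \<and> (\<forall>e\<in>N. \<forall>f\<in>N. e \<noteq> f \<longrightarrow> e \<inter> f = {})"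

definition optimal :: "'v set set \<Rightarrow> bool" where
  "optimal N \<longleftrightarrow> admissible N \<and> (\<forall>N'. admissible N' \<longrightarrow>
     num_components (M \<union> N) \<le> num_components (M \<union> N') \<and>
     (num_components (M \<union> N) = num_components (M \<union> N') \<longrightarrow> card N' \<le> card N))"

text \<open>Lying on a cycle is encoded as not being a bridge. In this form it can be followed
  through exchanges by comparing components, without any explicit cycle.\<close>

definition cycle_edge :: "'v set set \<Rightarrow> 'v \<Rightarrow> 'v \<Rightarrow> bool" where
  "cycle_edge N u w \<longleftrightarrow> {u, w} \<in> N \<and>
     component (M \<union> (N - {{u, w}})) u = component (M \<union> (N - {{u, w}})) w"

definition hole :: "'v set set \<Rightarrow> 'v \<Rightarrow> bool" where
  "hole N v \<longleftrightarrow> v \<in> U \<and> v \<notin> \<Union>N"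

lemma admissible_subset: "admissible N \<Longrightarrow> N' \<subseteq> N \<Longrightarrow> admissible N'"
  unfolding admissible_def by (meson subset_iff)

lemma admissible_insert:
  "admissible N \<Longrightarrow> {a, b} \<in> A \<Longrightarrow> a \<notin> \<Union>N \<Longrightarrow> b \<notin> \<Union>N \<Longrightarrow> admissible (insert {a, b} N)"
  unfolding admissible_def by auto

lemma admissible_unique: "admissible N \<Longrightarrow> e \<in> N \<Longrightarrow> f \<in> N \<Longrightarrow> v \<in> e \<Longrightarrow> v \<in> f \<Longrightarrow> e = f"
  unfolding admissible_def by (metis disjoint_iff)

lemma admissible_neq: "admissible N \<Longrightarrow> {u, w} \<in> N \<Longrightarrow> u \<noteq> w"
  unfolding admissible_def using A_edge by fastforce

lemma admissible_U: "admissible N \<Longrightarrow> e \<in> N \<Longrightarrow> v \<in> e \<Longrightarrow> v \<in> U"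
  unfolding admissible_def using A_sub by blast

lemma optimal_admissible: "optimal N \<Longrightarrow> admissible N"
  by (simp add: optimal_def)

lemma graph_edge: "admissible N \<Longrightarrow> e \<in> M \<union> N \<Longrightarrow> card e = 2"
  unfolding admissible_def by (metis M_edge A_edge Un_iff subsetD)

lemma valency_split:
  assumes "admissible N"
  shows "valency (M \<union> N) v \<le> valency M v + (if v \<in> \<Union>N then 1 else 0)"
proof -
  have "{e \<in> M \<union> N. v \<in> e} = {e \<in> M. v \<in> e} \<union> {e \<in> N. v \<in> e}" by blast
  moreover have "card {e \<in> N. v \<in> e} \<le> (if v \<in> \<Union>N then 1 else 0)"
  proof (cases "v \<in> \<Union>N")
    case True
    then obtain e where e: "e \<in> N" "v \<in> e" by auto
    then have "{e \<in> N. v \<in> e} = {e}" using admissible_unique[OF assms] by blast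
    then show ?thesis using True by simp
  next
    case False
    then have "{e \<in> N. v \<in> e} = {}" by blast
    then show ?thesis by (simp only: card.empty)
  qed
  ultimately show ?thesis
    unfolding valency_def
    by (metis (no_types, lifting) card_Un_le add_left_mono order_trans)
qed

lemma graph_valency: "admissible N \<Longrightarrow> valency (M \<union> N) v \<le> 2"
  using valency_split[of N v] M_valency[of v] M_valency_U[of v] admissible_U[of N]
  by (cases "v \<in> \<Union>N") auto

lemma hole_valency: "admissible N \<Longrightarrow> hole N v \<Longrightarrow> valency (M \<union> N) v \<le> 1"
  using valency_split[of N v] M_valency_U[of v] by (simp add: hole_def)

text \<open>A node of \<open>U\<close> has at most one edge in \<open>M\<close>, so a hole is an end
  of a path. When edges are stripped from \<open>N\<close> their ends become holes too, and this
  lemma then restricts how they can be linked.\<close>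

lemma three_holes:
  assumes "admissible N" "hole N a" "hole N b" "hole N c" "a \<noteq> b" "a \<noteq> c" "b \<noteq> c"
    and "component (M \<union> N) a = component (M \<union> N) b" "component (M \<union> N) a = component (M \<union> N) c"
  shows False
  using at_most_two_ends[OF graph_edge graph_valency, OF assms(1) _ assms(1), of a b c]
    assms hole_valency[OF assms(1)] by blast

lemma hole_removed:
  assumes "admissible N" "N' \<subseteq> N - {e}" "e \<in> N" "v \<in> e"
  shows "hole N' v"
  using assms admissible_U[of N e v] admissible_unique[OF assms(1) assms(3)]
  unfolding hole_def by blast

lemma hole_subset: "hole N v \<Longrightarrow> N' \<subseteq> N \<Longrightarrow> hole N' v"
  unfolding hole_def by blast

lemma hole_notin: "hole N v \<Longrightarrow> e \<in> N \<Longrightarrow> v \<notin> e"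
  unfolding hole_def by blast

lemma hole_insert [simp]: "hole (insert {a, b} N) v \<longleftrightarrow> hole N v \<and> v \<noteq> a \<and> v \<noteq> b"
  unfolding hole_def by blast

lemma admissible_insert_hole:
  "admissible N \<Longrightarrow> {a, b} \<in> A \<Longrightarrow> hole N a \<Longrightarrow> hole N b \<Longrightarrow> admissible (insert {a, b} N)"
  unfolding hole_def by (rule admissible_insert) auto

lemma cycle_edge_commute: "cycle_edge N u w \<longleftrightarrow> cycle_edge N w u"
  by (auto simp: cycle_edge_def insert_commute)

lemma edge_component: "{u, w} \<in> N \<Longrightarrow> component (M \<union> N) u = component (M \<union> N) w"
  by (metis UnI2 linked_edge linked_iff)

lemma remove_edge: "e \<in> N \<Longrightarrow> M \<union> N = insert e (M \<union> (N - {e}))"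
  by blast

lemma optimal_le: "optimal N \<Longrightarrow> admissible N' \<Longrightarrow> num_components (M \<union> N) \<le> num_components (M \<union> N')"
  by (simp add: optimal_def)

lemma optimal_less:
  "optimal N \<Longrightarrow> admissible N' \<Longrightarrow> card N < card N' \<Longrightarrow>
    num_components (M \<union> N) < num_components (M \<union> N')"
  unfolding optimal_def by (metis le_neq_implies_less not_less)

section \<open>Exchanges that optimality forbids\<close>

text \<open>Inserting the edge never raises the number of components, so it would beat
  \<open>N\<close> at least by the second criterion, the number of edges.\<close>

lemma no_adjacent_holes:
  assumes "optimal N" "hole N g" "hole N h" "{g, h} \<in> A"
  shows False
proof -
  have "{g, h} \<notin> N" using assms(2) hole_notin by blast
  then have "card N < card (insert {g, h} N)" by simp
  moreover have "admissible (insert {g, h} N)"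
    using assms optimal_admissible by (intro admissible_insert_hole) auto
  ultimately have "num_components (M \<union> N) < num_components (insert {g, h} (M \<union> N))"
    using optimal_less[OF assms(1)] by fastforce
  then show False using num_components_insert[of "M \<union> N" g h] by simp
qed

text \<open>Opening the cycle at \<open>{u, w}\<close> keeps its component together, and
  \<open>u\<close>, \<open>w\<close>, \<open>h\<close> would be three holes in it.\<close>

lemma hole_not_in_cycle:
  assumes "admissible N" "cycle_edge N u w" "hole N h"
  shows "component (M \<union> N) h \<noteq> component (M \<union> N) u"
proof
  assume eq: "component (M \<union> N) h = component (M \<union> N) u"
  have uw: "{u, w} \<in> N" and c: "component (M \<union> (N - {{u, w}})) u = component (M \<union> (N - {{u, w}})) w"
    using assms(2) by (auto simp: cycle_edge_def)
  have "h \<noteq> u" "h \<noteq> w" using hole_notin[OF assms(3) uw] by auto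
  moreover have "u \<noteq> w" using admissible_neq[OF assms(1) uw] .
  moreover have "component (M \<union> (N - {{u, w}})) u = component (M \<union> (N - {{u, w}})) h"
    using eq c unfolding remove_edge[OF uw] component_insert_eq by metis
  moreover have "hole (N - {{u, w}}) u" "hole (N - {{u, w}}) w"
    using hole_removed[OF assms(1) _ uw] by auto
  ultimately show False
    using three_holes[of "N - {{u, w}}" u w h] c
      admissible_subset[OF assms(1), of "N - {{u, w}}"] hole_subset[OF assms(3), of "N - {{u, w}}"]
    by auto
qed

text \<open>Exchange \<open>{u, w}\<close> for \<open>{h, u}\<close>: opening the cycle costs
  nothing, and the new edge attaches the component of \<open>h\<close>, which is a different
  one.\<close>

lemma cycle_edge_not_adjacent_hole:
  assumes "optimal N" "cycle_edge N u w" "hole N h" "{h, u} \<in> A"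
  shows False
proof -
  let ?N = "N - {{u, w}}"
  note adm = optimal_admissible[OF assms(1)]
  have uw: "{u, w} \<in> N" and c: "component (M \<union> ?N) u = component (M \<union> ?N) w"
    using assms(2) by (auto simp: cycle_edge_def)
  have "component (M \<union> ?N) h \<noteq> component (M \<union> ?N) u"
    using hole_not_in_cycle[OF adm assms(2,3)]
    unfolding remove_edge[OF uw] component_insert_eq by blast
  then have "num_components (M \<union> insert {h, u} ?N) < num_components (M \<union> ?N)"
    using num_components_insert[of "M \<union> ?N" h u] by simp
  also have "\<dots> = num_components (M \<union> N)"
    using num_components_insert[of "M \<union> ?N" u w] c remove_edge[OF uw] by simp
  also have "\<dots> \<le> num_components (M \<union> insert {h, u} ?N)"
    using assms(1,4) admissible_subset[OF adm, of ?N] hole_subset[OF assms(3), of ?N]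
      hole_removed[OF adm _ uw, of ?N u]
    by (intro optimal_le admissible_insert_hole) auto
  finally show False by simp
qed

text \<open>Drop both edges. If \<open>{a, b}\<close> were a bridge, \<open>u\<close> and
  \<open>w\<close> would still be linked to each other and to one of \<open>a\<close> and
  \<open>b\<close>, which makes three holes in one component.\<close>

lemma cycle_edge_same_component:
  assumes "admissible N" "cycle_edge N u w" "{a, b} \<in> N"
    and "component (M \<union> N) a = component (M \<union> N) u"
  shows "cycle_edge N a b"
proof (cases "{a, b} = {u, w}")
  case True
  then show ?thesis using assms(2) by (auto simp: cycle_edge_def doubleton_eq_iff insert_commute)
next
  case False
  let ?N = "N - {{u, w}, {a, b}}"
  have uw: "{u, w} \<in> N" using assms(2) by (simp add: cycle_edge_def)
  have N1: "M \<union> (N - {{u, w}}) = insert {a, b} (M \<union> ?N)"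
    using assms(3) False by blast
  have N2: "M \<union> (N - {{a, b}}) = insert {u, w} (M \<union> ?N)"
    using uw False by blast
  have N3: "M \<union> N = insert {u, w} (insert {a, b} (M \<union> ?N))"
    using uw assms(3) by blast
  have c: "component (insert {a, b} (M \<union> ?N)) u = component (insert {a, b} (M \<union> ?N)) w"
    using assms(2) N1 by (simp add: cycle_edge_def)
  note eq = assms(4)[unfolded N3 component_insert_eq]
  have holes: "hole ?N u" "hole ?N w" "hole ?N a" "hole ?N b"
    using hole_removed[OF assms(1) _ uw, of ?N] hole_removed[OF assms(1) _ assms(3), of ?N] by auto
  have "{u, w} \<inter> {a, b} = {}"
    using assms(1) uw assms(3) False unfolding admissible_def by metis
  then have d: "u \<noteq> w" "u \<noteq> a" "u \<noteq> b" "w \<noteq> a" "w \<noteq> b" "a \<noteq> b"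
    using admissible_neq[OF assms(1)] uw assms(3) by auto
  have adm: "admissible ?N" using assms(1) admissible_subset by blast
  have "component (insert {u, w} (M \<union> ?N)) a = component (insert {u, w} (M \<union> ?N)) b"
  proof (rule ccontr)
    assume n: "\<not> ?thesis"
    have "component (M \<union> ?N) u = component (M \<union> ?N) w"
      using c n unfolding component_insert_eq by metis
    moreover from this have "component (M \<union> ?N) u = component (M \<union> ?N) a \<or> component (M \<union> ?N) u = component (M \<union> ?N) b"
      using eq by metis
    ultimately show False
      using three_holes[OF adm holes(1,2,3)] three_holes[OF adm holes(1,2,4)] d by metis
  qed
  then show ?thesis using assms(3) N2 by (simp add: cycle_edge_def)
qed

text \<open>Open both cycles and join them by \<open>{w, u'}\<close>. \<open>N\<close> loses an
  edge, but the number of components drops, and that is compared first.\<close>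

lemma cycle_edges_not_adjacent:
  assumes "optimal N" "cycle_edge N u w" "cycle_edge N u' w'"
    and "component (M \<union> N) u \<noteq> component (M \<union> N) u'" "{w, u'} \<in> A"
  shows False
proof -
  let ?N = "N - {{u, w}, {u', w'}}"
  note adm = optimal_admissible[OF assms(1)]
  have uw: "{u, w} \<in> N" and uw': "{u', w'} \<in> N"
    using assms by (auto simp: cycle_edge_def)
  have ne: "{u, w} \<noteq> {u', w'}"
    using assms(4) edge_component[OF uw] edge_component[OF uw']
    by (auto simp: doubleton_eq_iff)
  have N1: "M \<union> (N - {{u, w}}) = insert {u', w'} (M \<union> ?N)" using uw' ne by blast
  have N2: "M \<union> (N - {{u', w'}}) = insert {u, w} (M \<union> ?N)" using uw ne by blast
  have N3: "M \<union> N = insert {u, w} (insert {u', w'} (M \<union> ?N))" using uw uw' by blast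
  note c = assms(2)[unfolded cycle_edge_def N1 component_insert_eq]
  note c' = assms(3)[unfolded cycle_edge_def N2 component_insert_eq]
  note eq = assms(4)[unfolded N3 component_insert_eq]
  have cc: "component (M \<union> ?N) u = component (M \<union> ?N) w" "component (M \<union> ?N) u' = component (M \<union> ?N) w'"
    "component (M \<union> ?N) w \<noteq> component (M \<union> ?N) u'"
    using c c' eq by metis+
  have "num_components (M \<union> insert {w, u'} ?N) < num_components (M \<union> ?N)"
    using num_components_insert[of "M \<union> ?N" w u'] cc by simp
  also have "\<dots> = num_components (M \<union> N)"
    unfolding N3 using num_components_insert[of "M \<union> ?N" u' w']
      num_components_insert[of "insert {u', w'} (M \<union> ?N)" u w] cc
    by (simp add: component_insert_eq)
  also have "\<dots> \<le> num_components (M \<union> insert {w, u'} ?N)"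
    using adm assms(1,5) hole_removed[OF adm _ uw, of ?N w] hole_removed[OF adm _ uw', of ?N u']
      admissible_subset[OF adm, of ?N]
    by (intro optimal_le admissible_insert_hole) auto
  finally show False by simp
qed

text \<open>If \<open>{a, b}\<close> is on a cycle, that cycle differs from one of the two others
  and the previous lemma applies. Otherwise open both cycles at no cost, cut the bridge
  \<open>{a, b}\<close> for one more component, and attach its two sides to the opened cycles for
  two fewer.\<close>

lemma cycle_edges_not_near:
  assumes "optimal N" "cycle_edge N u w" "{a, b} \<in> N" "cycle_edge N u' w'"
    and "component (M \<union> N) u \<noteq> component (M \<union> N) u'" "{w, a} \<in> A" "{b, u'} \<in> A"
  shows False
proof (cases "cycle_edge N a b")
  case True
  then show False
    using cycle_edges_not_adjacent[OF assms(1,2), of a b] cycle_edges_not_adjacent[OF assms(1) _ assms(4), of a b]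
      assms(5,6,7) by metis
next
  case False
  let ?N = "N - {{u, w}, {a, b}, {u', w'}}"
  note adm = optimal_admissible[OF assms(1)]
  have uw: "{u, w} \<in> N" and uw': "{u', w'} \<in> N"
    using assms by (auto simp: cycle_edge_def)
  have na: "component (M \<union> N) a \<noteq> component (M \<union> N) u" "component (M \<union> N) a \<noteq> component (M \<union> N) u'"
    using cycle_edge_same_component[OF adm _ assms(3)] assms(2,4) False by metis+
  have ne: "{u, w} \<noteq> {u', w'}" "{a, b} \<noteq> {u, w}" "{a, b} \<noteq> {u', w'}"
    using assms(5) na edge_component[OF uw] edge_component[OF uw']
    by (auto simp: doubleton_eq_iff)
  have N1: "M \<union> (N - {{u, w}}) = insert {a, b} (insert {u', w'} (M \<union> ?N))" using uw' assms(3) ne by blast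
  have N2: "M \<union> (N - {{u', w'}}) = insert {a, b} (insert {u, w} (M \<union> ?N))" using uw assms(3) ne by blast
  have N4: "M \<union> (N - {{a, b}}) = insert {u', w'} (insert {u, w} (M \<union> ?N))" using uw uw' ne by blast
  have N3: "M \<union> N = insert {a, b} (insert {u, w} (insert {u', w'} (M \<union> ?N)))" using uw uw' assms(3) by blast
  let ?c = "component (M \<union> ?N)"
  note c = assms(2)[unfolded cycle_edge_def N1 component_insert_eq]
  note c' = assms(4)[unfolded cycle_edge_def N2 component_insert_eq]
  note f = False[unfolded cycle_edge_def N4 component_insert_eq]
  have lift: "component (M \<union> N) x = component (M \<union> N) y" if "?c x = ?c y" for x y
    using component_mono_eq[OF that, of "M \<union> N"] by blast
  have ne': "?c x \<noteq> ?c y" if "x \<in> {u, w}" "y \<in> {a, b} \<or> y \<in> {u', w'}" for x y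
    using lift[of x y] that assms(5) na edge_component[OF uw] edge_component[OF uw']
      edge_component[OF assms(3)] by auto
  have ne'': "?c x \<noteq> ?c y" if "x \<in> {u', w'}" "y \<in> {a, b}" for x y
    using lift[of x y] that na edge_component[OF uw'] edge_component[OF assms(3)] by auto
  have cc: "?c u = ?c w" "?c u' = ?c w'" "?c a \<noteq> ?c b" "?c w \<noteq> ?c a" "?c w \<noteq> ?c b" "?c u' \<noteq> ?c a" "?c u' \<noteq> ?c b"
    "?c w \<noteq> ?c u'"
    using c c' f assms(3) ne' ne'' by auto
  have "num_components (M \<union> insert {b, u'} (insert {w, a} ?N)) + 2 = num_components (M \<union> ?N)"
    using num_components_insert[of "M \<union> ?N" w a]
      num_components_insert[of "insert {w, a} (M \<union> ?N)" b u'] cc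
    by (simp add: component_insert_eq)
  moreover have "num_components (M \<union> ?N) = num_components (M \<union> N) + 1"
    unfolding N3 using num_components_insert[of "M \<union> ?N" u' w']
      num_components_insert[of "insert {u', w'} (M \<union> ?N)" u w]
      num_components_insert[of "insert {u, w} (insert {u', w'} (M \<union> ?N))" a b] cc
    by (simp add: component_insert_eq)
  moreover have "num_components (M \<union> N) \<le> num_components (M \<union> insert {b, u'} (insert {w, a} ?N))"
  proof -
    have "hole ?N w" "hole ?N u'" "hole ?N a" "hole ?N b"
      using hole_removed[OF adm _ uw, of ?N w] hole_removed[OF adm _ uw', of ?N u']
        hole_removed[OF adm _ assms(3), of ?N a] hole_removed[OF adm _ assms(3), of ?N b] by blast+
    moreover have "b \<noteq> w" "b \<noteq> a" "u' \<noteq> w" "u' \<noteq> a" using cc by metis+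
    moreover have "admissible ?N" using admissible_subset[OF adm] by blast
    ultimately have "admissible (insert {b, u'} (insert {w, a} ?N))"
      using assms(6,7) by (intro admissible_insert_hole; simp)
    then show ?thesis using optimal_le[OF assms(1)] by blast
  qed
  ultimately show False by simp
qed

text \<open>Exchange \<open>{u, w}\<close> and \<open>{a, b}\<close> for \<open>{w, a}\<close> and
  \<open>{b, h}\<close>: opening the cycle is free, cutting \<open>{a, b}\<close> costs one
  component and \<open>{w, a}\<close> regains it. Hence \<open>{b, h}\<close> must not merge
  anything, so \<open>h\<close> is already linked to \<open>b\<close>, and the exchange is
  neutral.\<close>

lemma near_hole:
  assumes "optimal N" "cycle_edge N u w" "{a, b} \<in> N" "{a, b} \<noteq> {u, w}" "hole N h"
    and "{w, a} \<in> A" "{b, h} \<in> A"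
  defines "L \<equiv> N - {{u, w}, {a, b}}"
  shows "\<not> cycle_edge N a b" "component (M \<union> N) a \<noteq> component (M \<union> N) u"
    "component (M \<union> L) u = component (M \<union> L) w"
    "component (M \<union> L) a \<noteq> component (M \<union> L) b"
    "component (M \<union> L) h = component (M \<union> L) b"
    "admissible (insert {b, h} (insert {w, a} L))"
    "num_components (M \<union> insert {b, h} (insert {w, a} L)) = num_components (M \<union> N)"
    "card (insert {b, h} (insert {w, a} L)) = card N"
proof -
  note adm = optimal_admissible[OF assms(1)]
  have uw: "{u, w} \<in> N" using assms(2) by (simp add: cycle_edge_def)
  show nc: "\<not> cycle_edge N a b"
    using cycle_edge_not_adjacent_hole[OF assms(1) _ assms(5), of b a] assms(7)
    by (auto simp: insert_commute cycle_edge_commute)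
  then show na: "component (M \<union> N) a \<noteq> component (M \<union> N) u"
    using cycle_edge_same_component[OF adm assms(2,3)] by blast
  let ?c = "component (M \<union> L)"
  have N1: "M \<union> (N - {{u, w}}) = insert {a, b} (M \<union> L)" using assms(3,4) L_def by blast
  have N2: "M \<union> (N - {{a, b}}) = insert {u, w} (M \<union> L)" using uw assms(4) L_def by blast
  have N3: "M \<union> N = insert {a, b} (insert {u, w} (M \<union> L))" using uw assms(3) L_def by blast
  have lift: "component (M \<union> N) x = component (M \<union> N) y" if "?c x = ?c y" for x y
    using component_mono_eq[OF that, of "M \<union> N"] L_def by blast
  have ne: "?c x \<noteq> ?c y" if "x \<in> {u, w}" "y \<in> {a, b, h}" for x y
    using lift[of x y] that na hole_not_in_cycle[OF adm assms(2,5)] edge_component[OF uw]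
      edge_component[OF assms(3)] by auto
  show cu: "?c u = ?c w"
    using assms(2)[unfolded cycle_edge_def N1 component_insert_eq] ne by auto
  show ca: "?c a \<noteq> ?c b"
    using nc[unfolded cycle_edge_def N2 component_insert_eq] assms(3) by auto
  have wa: "?c w \<noteq> ?c a" "?c w \<noteq> ?c b" "?c w \<noteq> ?c h" using ne by auto
  have h1: "hole L u" "hole L w" "hole L a" "hole L b" "hole L h"
    using hole_removed[OF adm _ uw, of L u] hole_removed[OF adm _ uw, of L w]
      hole_removed[OF adm _ assms(3), of L a] hole_removed[OF adm _ assms(3), of L b]
      hole_subset[OF assms(5), of L]
    by (auto simp: L_def)
  have d: "b \<noteq> w" "b \<noteq> a" "h \<noteq> w" "h \<noteq> a" "h \<noteq> b"
    using wa ca hole_notin[OF assms(5,3)] by auto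
  show adm': "admissible (insert {b, h} (insert {w, a} L))"
    using assms(6,7) h1 d admissible_subset[OF adm, of L] by (intro admissible_insert_hole) (auto simp: L_def)
  have k1: "num_components (M \<union> L) = num_components (M \<union> N) + 1"
    unfolding N3 using num_components_insert[of "M \<union> L" u w]
      num_components_insert[of "insert {u, w} (M \<union> L)" a b] cu ca wa
    by (simp add: component_insert_eq)
  have k2: "num_components (M \<union> L) = num_components (M \<union> insert {b, h} (insert {w, a} L)) +
      (if ?c h = ?c b then 1 else 2)"
    using num_components_insert[of "M \<union> L" w a]
      num_components_insert[of "insert {w, a} (M \<union> L)" b h] cu ca wa
    by (auto simp add: component_insert_eq)
  \<comment> \<open>Otherwise \<open>k2\<close> would remove two components where \<open>k1\<close>
    has added only one, against optimality.\<close>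
  then show ch: "?c h = ?c b"
    using k1 optimal_le[OF assms(1) adm'] by (auto split: if_splits)
  show "num_components (M \<union> insert {b, h} (insert {w, a} L)) = num_components (M \<union> N)"
    using k1 k2 ch by simp
  have "card N = card L + 2"
  proof -
    have "N = insert {a, b} (insert {u, w} L)" using uw assms(3) L_def by blast
    moreover have "{a, b} \<notin> insert {u, w} L" "{u, w} \<notin> L" using assms(4) by (auto simp: L_def)
    ultimately show ?thesis by simp
  qed
  moreover have "{w, a} \<notin> L" "{b, h} \<notin> L" "{b, h} \<noteq> {w, a}"
    using hole_notin h1 d by (blast, blast, auto simp: doubleton_eq_iff)
  ultimately show "card (insert {b, h} (insert {w, a} L)) = card N" by simp
qed

text \<open>Shifting the hole over the edge and into the cycle yields another optimal choice, in
  which the hole has become part of a new cycle, while the other cycles are unaffected.\<close>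

lemma shift_hole:
  assumes "optimal N" "cycle_edge N u w" "{a, b} \<in> N" "{a, b} \<noteq> {u, w}" "hole N h"
    and "{w, a} \<in> A" "{b, h} \<in> A"
  defines "N' \<equiv> insert {b, h} (insert {w, a} (N - {{u, w}, {a, b}}))"
  shows "optimal N'" "cycle_edge N' b h"
    and "cycle_edge N x y \<Longrightarrow> component (M \<union> N) u \<noteq> component (M \<union> N) x \<Longrightarrow>
      cycle_edge N' x y \<and> component (M \<union> N') b \<noteq> component (M \<union> N') x"
proof -
  define L where "L = N - {{u, w}, {a, b}}"
  note nh = near_hole[OF assms(1-7), folded L_def]
  note adm = optimal_admissible[OF assms(1)]
  have N': "N' = insert {b, h} (insert {w, a} L)" by (simp add: N'_def L_def)
  show "optimal N'"
    unfolding optimal_def using nh(6,7,8) assms(1) unfolding N' optimal_def by simp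
  let ?c = "component (M \<union> L)"
  have uw: "{u, w} \<in> N" using assms(2) by (simp add: cycle_edge_def)
  have N3: "M \<union> N = insert {a, b} (insert {u, w} (M \<union> L))" using uw assms(3) L_def by blast
  have h1: "hole L w" "hole L a" "hole L b" "hole L h"
    using hole_removed[OF adm _ uw, of L w]
      hole_removed[OF adm _ assms(3), of L a] hole_removed[OF adm _ assms(3), of L b]
      hole_subset[OF assms(5), of L]
    by (auto simp: L_def)
  have "h \<noteq> w" "h \<noteq> a" using hole_notin[OF assms(5)] uw assms(3) by auto
  then have "{b, h} \<noteq> {w, a}" by (auto simp: doubleton_eq_iff)
  moreover have "{b, h} \<notin> L" using hole_notin h1 by blast
  ultimately have "M \<union> (N' - {{b, h}}) \<supseteq> M \<union> L" "{b, h} \<in> N'" by (auto simp: N')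
  then show "cycle_edge N' b h"
    unfolding cycle_edge_def using component_mono_eq[of "M \<union> L" b h] nh(5) by auto
  assume xy: "cycle_edge N x y" and ux: "component (M \<union> N) u \<noteq> component (M \<union> N) x"
  have xyN: "{x, y} \<in> N" using xy by (simp add: cycle_edge_def)
  have ax: "component (M \<union> N) a \<noteq> component (M \<union> N) x"
    using cycle_edge_same_component[OF adm xy assms(3)] nh(1) by auto
  have ne: "{x, y} \<noteq> {u, w}" "{x, y} \<noteq> {a, b}"
    using ux ax edge_component[OF uw] edge_component[OF assms(3)] by (auto simp: doubleton_eq_iff)
  then have xyL: "{x, y} \<in> L" using xyN L_def by blast
  let ?K = "L - {{x, y}}"
  have K: "M \<union> (N - {{x, y}}) = insert {a, b} (insert {u, w} (M \<union> ?K))"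
    using uw assms(3) ne L_def by blast
  have lift: "component (M \<union> N) p = component (M \<union> N) q" if "component (M \<union> ?K) p = component (M \<union> ?K) q" for p q
    using component_mono_eq[OF that, of "M \<union> N"] L_def by blast
  have lift': "component (M \<union> N) p = component (M \<union> N) q" if "?c p = ?c q" for p q
    using component_mono_eq[OF that, of "M \<union> N"] L_def by blast
  have far: "component (M \<union> ?K) x \<noteq> component (M \<union> ?K) p" "?c x \<noteq> ?c p" if "p \<in> {u, w, a, b}" for p
    using lift[of x p] lift'[of x p] ux ax that edge_component[OF uw] edge_component[OF assms(3)] by auto
  have "component (M \<union> ?K) x = component (M \<union> ?K) y"
    using xy[unfolded cycle_edge_def K component_insert_eq] far(1) by auto
  from component_mono_eq[OF this, of "M \<union> (N' - {{x, y}})"]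
  have "component (M \<union> (N' - {{x, y}})) x = component (M \<union> (N' - {{x, y}})) y"
    by (auto simp: N')
  then have "cycle_edge N' x y"
    unfolding cycle_edge_def using xyL by (simp add: N')
  moreover have "component (M \<union> N') b \<noteq> component (M \<union> N') x"
    unfolding N' Un_insert_right component_insert_eq using far(2) nh(5) by auto
  ultimately show "cycle_edge N' x y \<and> component (M \<union> N') b \<noteq> component (M \<union> N') x" by blast
qed

text \<open>A chain starts with a cycle edge at \<open>p 0\<close>, \<open>p 1\<close>, followed by edges at
  \<open>p (3j + 2)\<close>, \<open>p (3j + 3)\<close> that alternate with holes at \<open>p (3j + 4)\<close>.\<close>

definition chain :: "'v set set \<Rightarrow> nat \<Rightarrow> (nat \<Rightarrow> 'v) \<Rightarrow> bool" where
  "chain N r p \<longleftrightarrow> cycle_edge N (p 0) (p 1) \<and> (\<forall>j\<le>r. {p (3 * j + 2), p (3 * j + 3)} \<in> N) \<and>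
     (\<forall>j<r. hole N (p (3 * j + 4))) \<and> (\<forall>i. 1 \<le> i \<and> i < 3 * r + 3 \<longrightarrow> {p i, p (Suc i)} \<in> A)"

text \<open>Induction on the number of holes. Shifting the first hole turns
  \<open>{p 3, p 4}\<close> into a cycle edge, so the chain read from \<open>p 3\<close> has one
  hole fewer, while the cycle at the far end survives. Injectivity of \<open>p\<close> guarantees
  that the exchange leaves the rest of the chain intact.\<close>

lemma no_chain_between_cycles:
  assumes "optimal N" "chain N r p" "inj_on p {..3 * r + 5}"
    and "{p (3 * r + 3), p (3 * r + 4)} \<in> A" "cycle_edge N (p (3 * r + 4)) (p (3 * r + 5))"
    and "component (M \<union> N) (p 0) \<noteq> component (M \<union> N) (p (3 * r + 4))"
  shows False
  using assms
proof (induction r arbitrary: N p)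
  case 0
  show ?case
    by (rule cycle_edges_not_near[of N "p 0" "p 1" "p 2" "p 3" "p 4" "p 5"])
      (use 0 in \<open>auto simp: chain_def eval_nat_numeral\<close>)
next
  case (Suc r)
  let ?q = "\<lambda>i. p (i + 3)"
  have inj: "p i = p j \<longleftrightarrow> i = j" if "i \<le> 3 * r + 8" "j \<le> 3 * r + 8" for i j
    using Suc.prems(3) that by (auto simp: inj_on_eq_iff)
  have N: "{p (3 * j + 2), p (3 * j + 3)} \<in> N" if "j \<le> Suc r" for j
    using Suc.prems(2) that unfolding chain_def by blast
  have H: "hole N (p (3 * j + 4))" if "j < Suc r" for j
    using Suc.prems(2) that unfolding chain_def by blast
  have A: "{p i, p (Suc i)} \<in> A" if "1 \<le> i" "i < 3 * r + 6" for i
    using Suc.prems(2) that unfolding chain_def by auto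
  define N' where "N' = insert {p 3, p 4} (insert {p 1, p 2} (N - {{p 0, p 1}, {p 2, p 3}}))"
  have ne: "{p 2, p 3} \<noteq> {p 0, p 1}" by (auto simp: doubleton_eq_iff inj)
  have c: "cycle_edge N (p 0) (p 1)" using Suc.prems(2) unfolding chain_def by blast
  have "{p 2, p 3} \<in> N" "hole N (p 4)" "{p 1, p 2} \<in> A" "{p 3, p 4} \<in> A"
    using N[of 0] H[of 0] A[of 1] A[of 3] by (simp_all add: eval_nat_numeral)
  note shift = shift_hole[OF Suc.prems(1) c this(1) ne this(2-4), folded N'_def]
  have "chain N' r ?q"
    unfolding chain_def
  proof (intro conjI allI impI)
    show "cycle_edge N' (p (0 + 3)) (p (1 + 3))" using shift(2) by simp
    show "{p (3 * j + 2 + 3), p (3 * j + 3 + 3)} \<in> N'" if "j \<le> r" for j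
    proof -
      have "{p (3 * j + 2 + 3), p (3 * j + 3 + 3)} \<in> N"
        using N[of "Suc j"] that by (simp add: algebra_simps)
      moreover have "{p (3 * j + 2 + 3), p (3 * j + 3 + 3)} \<noteq> {p 0, p 1}"
        "{p (3 * j + 2 + 3), p (3 * j + 3 + 3)} \<noteq> {p 2, p 3}"
        using that by (auto simp: doubleton_eq_iff inj)
      ultimately show ?thesis by (simp add: N'_def)
    qed
    show "hole N' (p (3 * j + 4 + 3))" if "j < r" for j
    proof -
      have "hole N (p (3 * j + 4 + 3))" using H[of "Suc j"] that by (simp add: algebra_simps)
      then have "hole (N - {{p 0, p 1}, {p 2, p 3}}) (p (3 * j + 4 + 3))"
        by (rule hole_subset) blast
      then show ?thesis using that by (simp add: N'_def inj)
    qed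
    show "{p (i + 3), p (Suc i + 3)} \<in> A" if "1 \<le> i \<and> i < 3 * r + 3" for i
      using A[of "i + 3"] that by simp
  qed
  moreover have "inj_on ?q {..3 * r + 5}" by (auto simp: inj_on_def inj)
  moreover have "{?q (3 * r + 3), ?q (3 * r + 4)} \<in> A"
    using Suc.prems(4) by (simp add: algebra_simps)
  moreover have "cycle_edge N' (?q (3 * r + 4)) (?q (3 * r + 5)) \<and>
      component (M \<union> N') (?q 0) \<noteq> component (M \<union> N') (?q (3 * r + 4))"
    using shift(3)[of "p (3 * r + 7)" "p (3 * r + 8)"] Suc.prems(5,6) by (simp add: algebra_simps)
  ultimately show False using Suc.IH[OF shift(1)] by blast
qed

text \<open>Exchanging \<open>{a, b}\<close> for \<open>{g, a}\<close> and \<open>{b, h}\<close>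
  gains an edge, so it must raise the number of components. Cutting the bridge adds one; hence
  neither new edge may merge anything, \<open>g\<close> is linked to \<open>a\<close> and
  \<open>h\<close> to \<open>b\<close>, and \<open>{a, b}\<close> joins the two.\<close>

lemma holes_around_edge:
  assumes "optimal N" "hole N g" "hole N h" "g \<noteq> h" "{a, b} \<in> N" "{g, a} \<in> A" "{b, h} \<in> A"
  shows "component (M \<union> N) g = component (M \<union> N) h"
proof (rule ccontr)
  assume ne: "\<not> ?thesis"
  note adm = optimal_admissible[OF assms(1)]
  let ?L = "N - {{a, b}}"
  let ?c = "component (M \<union> ?L)"
  have N: "M \<union> N = insert {a, b} (M \<union> ?L)" using assms(5) by blast
  have "\<not> cycle_edge N a b"
    using cycle_edge_not_adjacent_hole[OF assms(1) _ assms(2,6)] by blast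
  then have ab: "?c a \<noteq> ?c b" using assms(5) by (simp add: cycle_edge_def)
  have holes: "hole ?L a" "hole ?L b" "hole ?L g" "hole ?L h"
    using hole_removed[OF adm _ assms(5), of ?L a] hole_removed[OF adm _ assms(5), of ?L b]
      hole_subset[OF assms(2), of ?L] hole_subset[OF assms(3), of ?L] by auto
  have d: "g \<noteq> a" "g \<noteq> b" "h \<noteq> a" "h \<noteq> b" "a \<noteq> b"
    using hole_notin[OF assms(2,5)] hole_notin[OF assms(3,5)] ab by auto
  let ?N = "insert {b, h} (insert {g, a} ?L)"
  have "admissible ?N"
    using assms(4,6,7) holes d admissible_subset[OF adm, of ?L] by (intro admissible_insert_hole) auto
  moreover have "card N < card ?N"
  proof -
    have "{g, a} \<notin> ?L" "{b, h} \<notin> ?L" "{b, h} \<noteq> {g, a}"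
      using holes hole_notin d assms(4) by (blast, blast, auto simp: doubleton_eq_iff)
    moreover have "card N = Suc (card ?L)"
      using card.remove[of N "{a, b}"] assms(5) by simp
    ultimately show ?thesis by simp
  qed
  ultimately have "num_components (M \<union> N) < num_components (M \<union> ?N)"
    by (rule optimal_less[OF assms(1)])
  then show False
    using ne ab num_components_insert[of "M \<union> ?L" a b] num_components_insert[of "M \<union> ?L" g a]
      num_components_insert[of "insert {g, a} (M \<union> ?L)" b h]
    unfolding N by (auto simp: component_insert_eq split: if_splits)
qed

text \<open>Here the alternating stretch leads back to the cycle edge it started from. Dropping all
  three edges gives two components more; then three edges of the heptagon can be inserted, each
  merging two components, for a total of one fewer.\<close>

lemma no_tight_heptagon:
  assumes "optimal N" "cycle_edge N p0 p1" "{p2, p3} \<in> N" "hole N p4" "{p5, p6} \<in> N"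
    and "distinct [p0, p1, p2, p3, p4, p5, p6]"
    and "{p1, p2} \<in> A" "{p3, p4} \<in> A" "{p4, p5} \<in> A" "{p6, p0} \<in> A"
  shows False
proof -
  note adm = optimal_admissible[OF assms(1)]
  have e: "{p0, p1} \<in> N" using assms(2) by (simp add: cycle_edge_def)
  have d: "{p2, p3} \<noteq> {p0, p1}" "{p6, p5} \<noteq> {p1, p0}" "{p2, p3} \<noteq> {p5, p6}"
    using assms(6) by (auto simp: doubleton_eq_iff)
  note R = near_hole[OF assms(1,2,3) d(1) assms(4,7,8)]
  have "cycle_edge N p1 p0" "{p6, p5} \<in> N" "{p0, p6} \<in> A" "{p5, p4} \<in> A"
    using assms(2,5,9,10) by (auto simp: insert_commute cycle_edge_commute)
  note L = near_hole[OF assms(1) this(1,2) d(2) assms(4) this(3,4)]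
  let ?L = "N - {{p0, p1}, {p2, p3}, {p5, p6}}"
  let ?c = "component (M \<union> ?L)"
  have N1: "M \<union> (N - {{p0, p1}, {p2, p3}}) = insert {p5, p6} (M \<union> ?L)"
    using assms(5) d by (auto simp: insert_commute)
  have N2: "M \<union> (N - {{p1, p0}, {p6, p5}}) = insert {p2, p3} (M \<union> ?L)"
    using assms(3) d by (auto simp: insert_commute)
  have N3: "M \<union> N = insert {p5, p6} (insert {p2, p3} (insert {p0, p1} (M \<union> ?L)))"
    using assms(3,5) e by blast
  have lift: "component (M \<union> N) x = component (M \<union> N) y" if "?c x = ?c y" for x y
    using component_mono_eq[OF that, of "M \<union> N"] by blast
  have far: "?c x \<noteq> ?c y" if "x \<in> {p0, p1}" "y \<in> {p2, p3, p4, p5, p6}" for x y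
    using lift[of x y] that R(2) L(2) hole_not_in_cycle[OF adm assms(2,4)] edge_component[OF e]
      edge_component[OF assms(3)] edge_component[OF assms(5)] by auto
  have c01: "?c p0 = ?c p1"
    using R(3)[unfolded N1 component_insert_eq] far by auto
  have holes: "hole ?L x" if "x \<in> {p0, p1, p2, p3, p4, p5, p6}" for x
    using that hole_removed[OF adm _ e, of ?L x] hole_removed[OF adm _ assms(3), of ?L x]
      hole_removed[OF adm _ assms(5), of ?L x] hole_subset[OF assms(4), of ?L] by auto
  have admL: "admissible ?L" using admissible_subset[OF adm, of ?L] by blast
  have three: "\<not> (?c x = ?c y \<and> ?c x = ?c z)"
    if "x \<in> {p2, p3, p4, p5, p6}" "y \<in> {p2, p3, p4, p5, p6}" "z \<in> {p2, p3, p4, p5, p6}"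
      "x \<noteq> y" "x \<noteq> z" "y \<noteq> z" for x y z
  proof -
    have "hole ?L x" "hole ?L y" "hole ?L z" by (rule holes; use that in blast)+
    then show ?thesis using three_holes[OF admL, of x y z] that(4-6) by blast
  qed
  have c23: "?c p2 \<noteq> ?c p3"
    using R(4)[unfolded N1 component_insert_eq] by blast
  have c56: "?c p5 \<noteq> ?c p6"
    using L(4)[unfolded N2 component_insert_eq] by metis
  have k: "num_components (M \<union> ?L) = num_components (M \<union> N) + 2"
  proof -
    have "\<not> (?c p5 = ?c p2 \<and> ?c p3 = ?c p6 \<or> ?c p5 = ?c p3 \<and> ?c p2 = ?c p6)"
      using R(4)[unfolded N1 component_insert_eq] by auto
    then show ?thesis
      unfolding N3 using num_components_insert[of "M \<union> ?L" p0 p1]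
        num_components_insert[of "insert {p0, p1} (M \<union> ?L)" p2 p3]
        num_components_insert[of "insert {p2, p3} (insert {p0, p1} (M \<union> ?L))" p5 p6] c01 c23 c56 far
      by (simp add: component_insert_eq)
  qed
  have dist: "p0 \<noteq> p1" "p0 \<noteq> p2" "p0 \<noteq> p3" "p0 \<noteq> p4" "p0 \<noteq> p5" "p0 \<noteq> p6" "p1 \<noteq> p2" "p1 \<noteq> p3" "p1 \<noteq> p4"
    "p1 \<noteq> p5" "p1 \<noteq> p6" "p2 \<noteq> p3" "p2 \<noteq> p4" "p2 \<noteq> p5" "p2 \<noteq> p6" "p3 \<noteq> p4" "p3 \<noteq> p5" "p3 \<noteq> p6" "p4 \<noteq> p5"
    "p4 \<noteq> p6" "p5 \<noteq> p6" using assms(6) by auto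
  \<comment> \<open>\<open>near_hole\<close> from the two sides links \<open>p4\<close> to
    \<open>p3\<close> and to \<open>p5\<close>, each time with one edge put back. If
    \<open>p4\<close> is linked to \<open>p3\<close> even without it, the link to \<open>p5\<close>
    must run through \<open>{p2, p3}\<close>; the second case is the mirror image.\<close>
  consider "?c p4 = ?c p3" "?c p2 = ?c p5" | "?c p4 = ?c p5" "?c p6 = ?c p3"
    using R(5)[unfolded N1 component_insert_eq] L(5)[unfolded N2 component_insert_eq]
      three[of p4 p3 p5] three[of p4 p2 p3] three[of p4 p5 p6] three[of p4 p6 p2] three[of p4 p6 p3] dist
    by (simp, metis)
  then show False
  proof cases
    case 1
    note eqs = c01[symmetric] 1(2)[symmetric] 1(1)
    have "?c p6 \<noteq> ?c p3" using three[of p4 p3 p6] 1 dist by simp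
    then have neqs: "?c p6 \<noteq> ?c p3" "?c p3 \<noteq> ?c p6" "?c p6 \<noteq> ?c p2" "?c p2 \<noteq> ?c p6" "?c p2 \<noteq> ?c p3" "?c p3 \<noteq> ?c p2"
      "?c p0 \<noteq> ?c p2" "?c p2 \<noteq> ?c p0" "?c p0 \<noteq> ?c p3" "?c p3 \<noteq> ?c p0" "?c p0 \<noteq> ?c p6" "?c p6 \<noteq> ?c p0"
      using c23 c56 1 far[of p0 p2] far[of p0 p3] far[of p0 p6] by auto
    have "num_components (M \<union> insert {p4, p5} (insert {p6, p0} (insert {p1, p2} ?L))) + 3 = num_components (M \<union> ?L)"
      using num_components_insert[of "M \<union> ?L" p1 p2]
        num_components_insert[of "insert {p1, p2} (M \<union> ?L)" p6 p0]
        num_components_insert[of "insert {p6, p0} (insert {p1, p2} (M \<union> ?L))" p4 p5]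
      by (simp add: component_insert_eq eqs neqs)
    moreover have "admissible (insert {p4, p5} (insert {p6, p0} (insert {p1, p2} ?L)))"
      using admL holes assms(7,9,10) dist by (intro admissible_insert_hole) auto
    ultimately show False using k optimal_le[OF assms(1)] by fastforce
  next
    case 2
    note eqs = c01[symmetric] 2
    have "?c p2 \<noteq> ?c p5" using three[of p4 p5 p2] 2 dist by simp
    then have neqs: "?c p5 \<noteq> ?c p3" "?c p3 \<noteq> ?c p5" "?c p5 \<noteq> ?c p2" "?c p2 \<noteq> ?c p5" "?c p2 \<noteq> ?c p3" "?c p3 \<noteq> ?c p2"
      "?c p0 \<noteq> ?c p2" "?c p2 \<noteq> ?c p0" "?c p0 \<noteq> ?c p3" "?c p3 \<noteq> ?c p0" "?c p0 \<noteq> ?c p5" "?c p5 \<noteq> ?c p0"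
      using c23 c56 2 far[of p0 p2] far[of p0 p3] far[of p0 p5] by auto
    have "num_components (M \<union> insert {p3, p4} (insert {p6, p0} (insert {p1, p2} ?L))) + 3 = num_components (M \<union> ?L)"
      using num_components_insert[of "M \<union> ?L" p1 p2]
        num_components_insert[of "insert {p1, p2} (M \<union> ?L)" p6 p0]
        num_components_insert[of "insert {p6, p0} (insert {p1, p2} (M \<union> ?L))" p3 p4]
      by (simp add: component_insert_eq eqs neqs)
    moreover have "admissible (insert {p3, p4} (insert {p6, p0} (insert {p1, p2} ?L)))"
      using admL holes assms(7,8,10) dist by (intro admissible_insert_hole) auto
    ultimately show False using k optimal_le[OF assms(1)] by fastforce
  qed
qed

end

section \<open>Discharging along the odd cycles\<close>

context half_edge_graph begin

lemma optimal_exists: "\<exists>N. optimal N"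
proof -
  \<comment> \<open>The factor \<open>Suc (card A)\<close> lets one component outweigh any
    difference in the number of edges, so that a minimum of \<open>?m\<close> is
    lexicographic.\<close>
  let ?m = "\<lambda>N. num_components (M \<union> N) * Suc (card A) + (card A - card N)"
  have "admissible {}" by (simp add: admissible_def)
  then obtain N where N: "admissible N" and min: "\<And>N'. admissible N' \<Longrightarrow> ?m N \<le> ?m N'"
    using ex_has_least_nat[of admissible "{}" ?m] by blast
  have le: "card N' \<le> card A" if "admissible N'" for N'
    using that by (auto simp: admissible_def intro: card_mono)
  have "num_components (M \<union> N) \<le> num_components (M \<union> N')" if "admissible N'" for N'
  proof (rule ccontr)
    assume "\<not> ?thesis"
    then have "Suc (num_components (M \<union> N')) * Suc (card A) \<le> num_components (M \<union> N) * Suc (card A)"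
      by (intro mult_le_mono) auto
    then show False using min[OF that] by simp
  qed
  moreover have "card N' \<le> card N"
    if "admissible N'" "num_components (M \<union> N) = num_components (M \<union> N')" for N'
    using min[OF that(1)] that(2) le[OF that(1)] le[OF N] by simp
  ultimately show ?thesis using N unfolding optimal_def by blast
qed

end

text \<open>\<open>\<sigma>\<close> runs around the odd cycles in one direction. Oddness is stated
  for orbits, where injectivity makes \<open>n\<close> the exact period. \<open>M_acyclic\<close> is
  the form in which connectivity of the support enters.\<close>

locale half_edge_cycles = half_edge_graph M A U for M A :: "'v::finite set set" and U :: "'v set" +
  fixes \<sigma> :: "'v \<Rightarrow> 'v"
  assumes \<sigma>_bij: "bij_betw \<sigma> U U"
    and \<sigma>_neq: "v \<in> U \<Longrightarrow> \<sigma> v \<noteq> v"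
    and \<sigma>_neq2: "v \<in> U \<Longrightarrow> \<sigma> (\<sigma> v) \<noteq> v"
    and A_\<sigma>: "e \<in> A \<Longrightarrow> \<exists>v\<in>U. e = {v, \<sigma> v}"
    and \<sigma>_odd: "v \<in> U \<Longrightarrow> 0 < n \<Longrightarrow> (\<sigma> ^^ n) v = v \<Longrightarrow> inj_on (\<lambda>i. (\<sigma> ^^ i) v) {..<n} \<Longrightarrow> odd n"
    and M_A: "M \<inter> A = {}"
    and M_acyclic: "\<exists>u\<in>component M v. valency M u \<noteq> 2"

locale optimal_choice = half_edge_cycles M A U \<sigma>
  for M A :: "'v::finite set set" and U :: "'v set" and \<sigma> :: "'v \<Rightarrow> 'v" +
  fixes N :: "'v set set"
  assumes opt: "optimal N"
begin

lemma adm: "admissible N" by (rule optimal_admissible[OF opt])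

lemma NA: "N \<subseteq> A" using adm by (simp add: admissible_def)

lemma \<sigma>_U [simp]: "v \<in> U \<Longrightarrow> \<sigma> v \<in> U"
  using \<sigma>_bij by (auto simp: bij_betw_def)

lemma \<sigma>_inj: "u \<in> U \<Longrightarrow> v \<in> U \<Longrightarrow> \<sigma> u = \<sigma> v \<longleftrightarrow> u = v"
  using \<sigma>_bij by (auto simp: bij_betw_def inj_on_eq_iff)

lemma \<sigma>_pow_U [simp]: "v \<in> U \<Longrightarrow> (\<sigma> ^^ i) v \<in> U"
  by (induction i) auto

lemma \<sigma>_edge_inj: "u \<in> U \<Longrightarrow> v \<in> U \<Longrightarrow> {u, \<sigma> u} = {v, \<sigma> v} \<longleftrightarrow> u = v"
  using \<sigma>_neq2 by (auto simp: doubleton_eq_iff)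

lemma N_\<sigma>: "e \<in> N \<Longrightarrow> \<exists>v\<in>U. e = {v, \<sigma> v}"
  using NA A_\<sigma> by blast

lemma \<sigma>_edge_eq: "u \<in> U \<Longrightarrow> v \<in> U \<Longrightarrow> {u, \<sigma> u} \<in> N \<Longrightarrow> {v, \<sigma> v} \<in> N \<Longrightarrow>
    x \<in> {u, \<sigma> u} \<Longrightarrow> x \<in> {v, \<sigma> v} \<Longrightarrow> u = v"
  using admissible_unique[OF adm] \<sigma>_edge_inj by metis

section \<open>Tokens: the odd cycles cut into matching edges and holes\<close>

text \<open>Tokens are the blocks met when walking along \<open>\<sigma>\<close>; an edge of
  \<open>N\<close> is represented by the node at which the walk enters it.\<close>

definition token :: "'v \<Rightarrow> bool" where
  "token v \<longleftrightarrow> v \<in> U \<and> ({v, \<sigma> v} \<in> N \<or> hole N v)"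

definition token_end :: "'v \<Rightarrow> 'v" where
  "token_end v = (if {v, \<sigma> v} \<in> N then \<sigma> v else v)"

definition next_token :: "'v \<Rightarrow> 'v" where "next_token v = \<sigma> (token_end v)"

text \<open>In the application this is a half edge of cost 2: no exchange can use it, but it brings
  7/12.\<close>

definition wall :: "'v \<Rightarrow> bool" where "wall v \<longleftrightarrow> {token_end v, \<sigma> (token_end v)} \<notin> A"

definition cyclic :: "'v \<Rightarrow> bool" where "cyclic v \<longleftrightarrow> v \<in> U \<and> cycle_edge N v (\<sigma> v)"

definition mult :: "'v \<Rightarrow> nat" where
  "mult v = card {e \<in> N. e \<subseteq> component (M \<union> N) v}"

text \<open>A cycle divides its unit cost evenly among its edges in \<open>N\<close>; if there is only one such
  edge, the cycle has a node outside \<open>U\<close>, which contributes 1/6.\<close>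

definition demand :: "'v \<Rightarrow> real" where
  "demand v = (if mult v = 1 then 5 / 6 else 1 / mult v)"

text \<open>Tightness records that a walk from some cycle edge up to this token met no wall and
  alternated strictly. Position \<open>3 * r + 2\<close> is the first node of the last edge of the
  chain, and \<open>3 * r + 4\<close> in \<open>tight_hole\<close> is the hole behind that
  edge.\<close>

definition tight_edge :: "'v \<Rightarrow> bool" where
  "tight_edge v \<longleftrightarrow> (\<exists>r. \<exists>x\<in>U. chain N r (\<lambda>i. (\<sigma> ^^ i) x) \<and> v = (\<sigma> ^^ (3 * r + 2)) x)"

definition tight_hole :: "'v \<Rightarrow> bool" where
  "tight_hole v \<longleftrightarrow> hole N v \<and> (\<exists>r. \<exists>x\<in>U. chain N r (\<lambda>i. (\<sigma> ^^ i) x) \<and>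
     v = (\<sigma> ^^ (3 * r + 4)) x \<and> {(\<sigma> ^^ (3 * r + 3)) x, v} \<in> A)"

lemma hole_no_edge: "hole N v \<Longrightarrow> {v, \<sigma> v} \<notin> N"
  using hole_notin by blast

lemma token_end_U: "token v \<Longrightarrow> token_end v \<in> U" by (simp add: token_def token_end_def)

lemma token_end_inj: "inj_on token_end {v. token v}"
proof (rule inj_onI)
  fix u v assume uv: "u \<in> {v. token v}" "v \<in> {v. token v}" "token_end u = token_end v"
  then have "u \<in> U" "v \<in> U" by (auto simp: token_def)
  then show "u = v"
    using uv \<sigma>_inj hole_notin[of N u "{v, \<sigma> v}"] hole_notin[of N v "{u, \<sigma> u}"]
    by (auto simp: token_def token_end_def split: if_splits)
qed

text \<open>If the node behind a token were the second node of an edge of \<open>N\<close>, this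
  edge would begin at the token's end, which is a hole or already the second node of another edge of
  \<open>N\<close>.\<close>

lemma next_token_token:
  assumes "token v"
  shows "token (next_token v)"
proof (rule ccontr)
  assume n: "\<not> token (next_token v)"
  let ?z = "token_end v"
  have zU: "?z \<in> U" using token_end_U[OF assms] .
  then have "\<sigma> ?z \<in> \<Union>N" "{\<sigma> ?z, \<sigma> (\<sigma> ?z)} \<notin> N"
    using n by (auto simp: token_def next_token_def hole_def)
  then obtain e where e: "e \<in> N" "\<sigma> ?z \<in> e" by blast
  then obtain y where y: "y \<in> U" "e = {y, \<sigma> y}" using N_\<sigma> by blast
  have "\<sigma> ?z = \<sigma> y" using y e \<open>{\<sigma> ?z, \<sigma> (\<sigma> ?z)} \<notin> N\<close> by auto
  then have zN: "{?z, \<sigma> ?z} \<in> N" using \<sigma>_inj[OF zU y(1)] e y by simp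
  show False
  proof (cases "{v, \<sigma> v} \<in> N")
    case True
    then show False
      using zN \<sigma>_edge_eq[of v "\<sigma> v" "\<sigma> v"] assms \<sigma>_neq[of v] by (auto simp: token_end_def token_def)
  next
    case False
    then show False using zN by (simp add: token_end_def)
  qed
qed

lemma next_token_bij: "bij_betw next_token {v. token v} {v. token v}"
proof -
  have "inj_on next_token {v. token v}"
  proof (rule inj_onI)
    fix u v assume uv: "u \<in> {v. token v}" "v \<in> {v. token v}" "next_token u = next_token v"
    then have "token_end u = token_end v" using \<sigma>_inj token_end_U by (simp add: next_token_def)
    then show "u = v" using token_end_inj uv by (meson inj_onD)
  qed
  moreover have "next_token ` {v. token v} \<subseteq> {v. token v}" using next_token_token by blast
  ultimately show ?thesis by (simp add: bij_betw_def endo_inj_surj)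
qed

lemma mult_pos: "cyclic v \<Longrightarrow> 1 \<le> mult v"
proof -
  assume v: "cyclic v"
  then have "{v, \<sigma> v} \<in> {e \<in> N. e \<subseteq> component (M \<union> N) v}"
    using edge_component[of v "\<sigma> v" N] by (auto simp: cyclic_def cycle_edge_def mem_component)
  then have "0 < mult v" unfolding mult_def by (subst card_gt_0_iff) auto
  then show ?thesis by simp
qed

lemma no_hole_hole: "hole N u \<Longrightarrow> hole N (next_token u) \<Longrightarrow> wall u"
  using no_adjacent_holes[OF opt, of u "\<sigma> u"] hole_no_edge[of u] by (auto simp: wall_def token_end_def next_token_def)

lemma no_cyclic_hole: "cyclic u \<Longrightarrow> hole N (next_token u) \<Longrightarrow> wall u"
  using cycle_edge_not_adjacent_hole[OF opt, of "\<sigma> u" u "\<sigma> (\<sigma> u)"]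
  by (auto simp: cyclic_def wall_def token_end_def next_token_def cycle_edge_def insert_commute split: if_splits)

lemma no_hole_cyclic: "hole N u \<Longrightarrow> cyclic (next_token u) \<Longrightarrow> wall u"
  using cycle_edge_not_adjacent_hole[OF opt, of "\<sigma> u" "\<sigma> (\<sigma> u)" u] hole_no_edge[of u]
  by (auto simp: cyclic_def wall_def token_end_def next_token_def)

lemma cyclic_cyclic:
  "cyclic u \<Longrightarrow> cyclic (next_token u) \<Longrightarrow> \<not> wall u \<Longrightarrow> component (M \<union> N) (next_token u) = component (M \<union> N) u"
  using cycle_edges_not_adjacent[OF opt, of u "\<sigma> u" "\<sigma> (\<sigma> u)" "\<sigma> (\<sigma> (\<sigma> u))"]
  by (auto simp: cyclic_def wall_def token_end_def next_token_def cycle_edge_def)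

lemma tight_start:
  assumes "cyclic u" "{next_token u, \<sigma> (next_token u)} \<in> N" "\<not> wall u"
  shows "tight_edge (next_token u)"
  unfolding tight_edge_def
proof (intro exI[of _ 0] bexI[of _ u] conjI)
  have uN: "{u, \<sigma> u} \<in> N" using assms by (simp add: cyclic_def cycle_edge_def)
  then have "{\<sigma> u, \<sigma> (\<sigma> u)} \<in> A" "{\<sigma> (\<sigma> u), \<sigma> (\<sigma> (\<sigma> u))} \<in> N"
    using assms by (auto simp: wall_def token_end_def next_token_def)
  moreover have "cycle_edge N u (\<sigma> u)" using assms(1) by (simp add: cyclic_def)
  moreover have "{(\<sigma> ^^ i) u, (\<sigma> ^^ Suc i) u} \<in> A" if "1 \<le> i \<and> i < 3 * 0 + 3" for i
  proof -
    have "i = 1 \<or> i = 2" using that by linarith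
    then show ?thesis
    proof
      assume "i = 1"
      then show ?thesis using calculation(1) by simp
    next
      assume "i = 2"
      then show ?thesis using calculation(2) NA by (simp add: eval_nat_numeral subsetD)
    qed
  qed
  ultimately show "chain N 0 (\<lambda>i. (\<sigma> ^^ i) u)"
    unfolding chain_def by (simp add: eval_nat_numeral)
  show "next_token u = (\<sigma> ^^ (3 * 0 + 2)) u" using uN by (simp add: next_token_def token_end_def eval_nat_numeral)
  show "u \<in> U" using assms by (simp add: cyclic_def)
qed

lemma tight_edge_hole:
  assumes "tight_edge u" "hole N (next_token u)" "\<not> wall u"
  shows "tight_hole (next_token u)"
proof -
  obtain r x where x: "x \<in> U" "chain N r (\<lambda>i. (\<sigma> ^^ i) x)" "u = (\<sigma> ^^ (3 * r + 2)) x"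
    using assms(1) unfolding tight_edge_def by blast
  have "(\<sigma> ^^ (3 * r + 3)) x = \<sigma> u" "(\<sigma> ^^ (3 * r + 4)) x = \<sigma> (\<sigma> u)"
    using x(3) by (simp_all add: eval_nat_numeral)
  moreover have "{u, \<sigma> u} \<in> N"
    using x calculation(1) unfolding chain_def by (metis order_refl)
  ultimately have "next_token u = (\<sigma> ^^ (3 * r + 4)) x" "{(\<sigma> ^^ (3 * r + 3)) x, next_token u} \<in> A"
    using assms(3) by (simp_all add: next_token_def token_end_def wall_def)
  then show ?thesis using assms(2) x(1,2) unfolding tight_hole_def by blast
qed

lemma tight_hole_edge:
  assumes "tight_hole u" "{next_token u, \<sigma> (next_token u)} \<in> N" "\<not> wall u"
  shows "tight_edge (next_token u)"
proof -
  obtain r x where x: "x \<in> U" "chain N r (\<lambda>i. (\<sigma> ^^ i) x)" "u = (\<sigma> ^^ (3 * r + 4)) x"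
      "{(\<sigma> ^^ (3 * r + 3)) x, u} \<in> A"
    using assms(1) unfolding tight_hole_def by blast
  have h: "hole N u" using assms(1) by (simp add: tight_hole_def)
  have p: "(\<sigma> ^^ (3 * r + 5)) x = \<sigma> u" "(\<sigma> ^^ (3 * r + 6)) x = \<sigma> (\<sigma> u)"
    using x(3) by (simp_all add: eval_nat_numeral)
  have su: "{\<sigma> u, \<sigma> (\<sigma> u)} \<in> N" "{u, \<sigma> u} \<in> A"
    using assms(2,3) hole_no_edge[OF h] by (auto simp: next_token_def token_end_def wall_def)
  have "chain N (Suc r) (\<lambda>i. (\<sigma> ^^ i) x)"
    unfolding chain_def
  proof (intro conjI allI impI)
    show "cycle_edge N ((\<sigma> ^^ 0) x) ((\<sigma> ^^ 1) x)" using x(2) by (simp add: chain_def)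
    show "{(\<sigma> ^^ (3 * j + 2)) x, (\<sigma> ^^ (3 * j + 3)) x} \<in> N" if "j \<le> Suc r" for j
    proof (cases "j = Suc r")
      case True
      then have "3 * j + 2 = 3 * r + 5" "3 * j + 3 = 3 * r + 6" by simp_all
      then show ?thesis using su p by metis
    next
      case False
      then show ?thesis using x(2) that unfolding chain_def by simp
    qed
    show "hole N ((\<sigma> ^^ (3 * j + 4)) x)" if "j < Suc r" for j
      using x(2,3) h that unfolding chain_def by (cases "j = r") auto
    show "{(\<sigma> ^^ i) x, (\<sigma> ^^ Suc i) x} \<in> A" if "1 \<le> i \<and> i < 3 * Suc r + 3" for i
    proof -
      have "i < 3 * r + 3 \<or> i = 3 * r + 3 \<or> i = 3 * r + 4 \<or> i = 3 * r + 5" using that by presburger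
      then consider "i < 3 * r + 3" | "i = 3 * r + 3" | "i = 3 * r + 4" | "i = 3 * r + 5" by blast
      then show ?thesis
      proof cases
        case 1
        then show ?thesis using x(2) that unfolding chain_def by blast
      next
        case 2
        then have "Suc i = 3 * r + 4" by simp
        then show ?thesis using 2 x(3,4) by metis
      next
        case 3
        then have "Suc i = 3 * r + 5" by simp
        then show ?thesis using 3 x(3) p(1) su(2) by metis
      next
        case 4
        then have "Suc i = 3 * r + 6" by simp
        then show ?thesis using 4 p su(1) NA by (metis subsetD)
      qed
    qed
  qed
  moreover have "next_token u = (\<sigma> ^^ (3 * Suc r + 2)) x"
  proof -
    have "3 * Suc r + 2 = 3 * r + 5" by simp
    then show ?thesis using p(1) hole_no_edge[OF h] by (simp only: next_token_def token_end_def if_False)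
  qed
  ultimately show ?thesis unfolding tight_edge_def using x(1) by blast
qed

lemma pow_cancel:
  assumes "x \<in> U" "(\<sigma> ^^ i) x = (\<sigma> ^^ (i + d)) x"
  shows "(\<sigma> ^^ d) x = x"
  using assms(2)
proof (induction i)
  case (Suc i)
  then have "\<sigma> ((\<sigma> ^^ i) x) = \<sigma> ((\<sigma> ^^ (i + d)) x)" by simp
  then show ?case using Suc.IH \<sigma>_inj assms(1) by simp
qed simp

text \<open>A repetition can be moved back to the start by cancelling, so only returns to
  \<open>x\<close> have to be excluded.\<close>

lemma pow_inj:
  assumes "x \<in> U" "\<And>d. 0 < d \<Longrightarrow> d < n \<Longrightarrow> (\<sigma> ^^ d) x \<noteq> x"
  shows "inj_on (\<lambda>i. (\<sigma> ^^ i) x) {..<n}"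
proof (rule linorder_inj_onI')
  fix i j assume ij: "i \<in> {..<n}" "j \<in> {..<n}" "i < j"
  show "(\<sigma> ^^ i) x \<noteq> (\<sigma> ^^ j) x"
    using pow_cancel[OF assms(1), of i "j - i"] assms(2)[of "j - i"] ij by auto
qed

text \<open>The two edges would fill an orbit of even length 4.\<close>

lemma no_cycle_of_two_edges:
  assumes "token u" "{u, \<sigma> u} \<in> N" "{next_token u, \<sigma> (next_token u)} \<in> N" "next_token (next_token u) = u"
  shows False
proof -
  have u: "u \<in> U" using assms(1) by (simp add: token_def)
  have nx: "next_token u = \<sigma> (\<sigma> u)" "next_token (next_token u) = \<sigma> (\<sigma> (\<sigma> (\<sigma> u)))"
    using assms(2,3) by (auto simp: next_token_def token_end_def)
  have "(\<sigma> ^^ d) u \<noteq> u" if "0 < d" "d < 4" for d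
  proof -
    have "d = 1 \<or> d = 2 \<or> d = 3" using that by linarith
    moreover have "\<sigma> (\<sigma> (\<sigma> u)) \<noteq> u"
    proof
      assume "\<sigma> (\<sigma> (\<sigma> u)) = u"
      then have "\<sigma> u = u" using nx assms(4) by simp
      then show False using \<sigma>_neq u by blast
    qed
    ultimately show ?thesis using \<sigma>_neq[OF u] \<sigma>_neq2[OF u] by (auto simp: eval_nat_numeral)
  qed
  then have "inj_on (\<lambda>i. (\<sigma> ^^ i) u) {..<4}" by (rule pow_inj[OF u])
  then have "odd (4 :: nat)" using \<sigma>_odd[OF u, of 4] nx(2) assms(4) by (simp add: eval_nat_numeral)
  then show False by simp
qed

text \<open>The critical case of the discharging: a tight edge carries too little for a cycle with a
  single edge. Either the chain joins two different cycles, or that single edge is the one at which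
  the chain started and the chain fills an orbit of length \<open>3 * r + 4\<close>.\<close>

lemma tight_edge_cyclic:
  assumes "tight_edge u" "\<not> cyclic u" "cyclic (next_token u)" "\<not> wall u"
  shows "mult (next_token u) \<noteq> 1"
proof
  assume m1: "mult (next_token u) = 1"
  obtain r x where x: "x \<in> U" "chain N r (\<lambda>i. (\<sigma> ^^ i) x)" "u = (\<sigma> ^^ (3 * r + 2)) x"
    using assms(1) unfolding tight_edge_def by blast
  define p where "p i = (\<sigma> ^^ i) x" for i
  have pU: "p i \<in> U" for i using x(1) by (simp add: p_def)
  have pS: "p (Suc i) = \<sigma> (p i)" for i by (simp add: p_def)
  have ch: "chain N r p" using x(2) by (simp add: p_def[abs_def])
  have up: "u = p (3 * r + 2)" "\<sigma> u = p (3 * r + 3)" "\<sigma> (\<sigma> u) = p (3 * r + 4)"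
    using x(3) by (simp_all add: p_def eval_nat_numeral)
  have c0: "cycle_edge N (p 0) (p 1)" and
    edges: "\<And>j. j \<le> r \<Longrightarrow> {p (3 * j + 2), p (3 * j + 3)} \<in> N" and
    holes: "\<And>j. j < r \<Longrightarrow> hole N (p (3 * j + 4))" and
    links: "\<And>i. 1 \<le> i \<Longrightarrow> i < 3 * r + 3 \<Longrightarrow> {p i, p (Suc i)} \<in> A"
    using ch unfolding chain_def by blast+
  have e0: "{p 0, p 1} \<in> N" using c0 by (simp add: cycle_edge_def)
  have uN: "{u, \<sigma> u} \<in> N" using edges[of r] up by simp
  have v: "next_token u = p (3 * r + 4)" and link: "{p (3 * r + 3), p (3 * r + 4)} \<in> A"
    using uN assms(4) up by (auto simp: next_token_def token_end_def wall_def)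
  have cv: "cycle_edge N (p (3 * r + 4)) (p (3 * r + 5))"
    using assms(3) v pS[of "3 * r + 4"] by (simp add: cyclic_def eval_nat_numeral)
  \<comment> \<open>The last edge of the chain is not on a cycle by assumption, the earlier ones
    because a hole follows them.\<close>
  have nc: "\<not> cycle_edge N (p (3 * j + 2)) (p (3 * j + 3))" if "j \<le> r" for j
  proof (cases "j = r")
    case True
    then show ?thesis using assms(2) up pU by (simp add: cyclic_def)
  next
    case False
    then have "hole N (p (3 * j + 4))" "{p (3 * j + 3), p (3 * j + 4)} \<in> A"
      using holes[of j] links[of "3 * j + 3"] that by (auto simp: eval_nat_numeral)
    then show ?thesis
      using cycle_edge_not_adjacent_hole[OF opt, of "p (3 * j + 3)" "p (3 * j + 2)" "p (3 * j + 4)"]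
        cycle_edge_commute[of N "p (3 * j + 3)"] insert_commute[of "p (3 * j + 3)" "p (3 * j + 4)" "{}"]
      by metis
  qed
  have partner: "y = \<sigma> (p 0)" if "{y, p 0} \<in> N" for y
  proof -
    have "{y, p 0} = {p 0, p 1}" using admissible_unique[OF adm that e0, of "p 0"] by simp
    then show ?thesis using pS[of 0] by (auto simp: doubleton_eq_iff)
  qed
  \<comment> \<open>As \<open>p 0\<close> is the first node of a cycle edge, it cannot be a hole,
    the second node of an edge, or the first node of an edge of the chain. Only position
    \<open>3 * r + 4\<close> is left open.\<close>
  have no_return: "p d \<noteq> p 0" if d: "0 < d" "d \<le> 3 * r + 3 \<or> d = 3 * r + 5" for d
  proof
    assume ret: "p d = p 0"
    have nback: False if "d = Suc y" "{p y, p (Suc y)} \<in> N" for y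
      using partner[of "p y"] that ret pS[of y] \<sigma>_neq2[OF pU[of 0]] by auto
    consider j where "d = 3 * j + 2" "j \<le> r" | j where "d = 3 * j + 3" "j \<le> r"
      | j where "d = 3 * j + 4" "j < r" | "d = 1" | "d = 3 * r + 5"
    proof -
      have "d = 3 * (d div 3) \<or> d = 3 * (d div 3) + 1 \<or> d = 3 * (d div 3) + 2" by presburger
      then show thesis
      proof (elim disjE)
        assume *: "d = 3 * (d div 3)"
        then have "d = 3 * (d div 3 - 1) + 3" "d div 3 - 1 \<le> r \<or> d = 3 * r + 5" using d by linarith+
        then show thesis using that by blast
      next
        assume *: "d = 3 * (d div 3) + 1"
        show thesis
        proof (cases "d = 1")
          case False
          define k where "k = d div 3"
          have "d = 3 * k + 1" using * by (simp add: k_def)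
          then have "d = 3 * (k - 1) + 4" "k - 1 < r" using d False by presburger+
          then show thesis using that by blast
        qed (use that in blast)
      next
        assume *: "d = 3 * (d div 3) + 2"
        then have "d div 3 \<le> r \<or> d = 3 * r + 5" using d by linarith
        then show thesis using that * by blast
      qed
    qed
    then show False
    proof cases
      case 1
      have "p (3 * j + 3) = p 1"
        using pS[of "3 * j + 2"] pS[of 0] 1 ret by (simp add: eval_nat_numeral)
      then show False using nc[OF 1(2)] 1 ret c0 by simp
    next
      case 2
      then show False using nback[of "3 * j + 2"] edges[OF 2(2)] by (simp add: eval_nat_numeral)
    next
      case 3
      then show False using holes[OF 3(2)] hole_notin[of N "p 0"] e0 ret by auto
    next
      case 4
      then show False using pS[of 0] \<sigma>_neq[OF pU[of 0]] ret by simp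
    next
      case 5
      then show False using nback[of "3 * r + 4"] cv by (simp add: cycle_edge_def eval_nat_numeral)
    qed
  qed
  show False
  proof (cases "p (3 * r + 4) = p 0")
    case False
    have "component (M \<union> N) (p 0) \<noteq> component (M \<union> N) (p (3 * r + 4))"
    \<comment> \<open>Since the cycle at \<open>p (3 * r + 4)\<close> has a single edge, a common
      component would identify this edge with \<open>{p 0, p 1}\<close>.\<close>
    proof
      assume eq: "component (M \<union> N) (p 0) = component (M \<union> N) (p (3 * r + 4))"
      let ?E = "{e \<in> N. e \<subseteq> component (M \<union> N) (next_token u)}"
      have vN: "{p (3 * r + 4), p (3 * r + 5)} \<in> N" using cv by (simp add: cycle_edge_def)
      have "{p 0, p 1} \<in> ?E" "{p (3 * r + 4), p (3 * r + 5)} \<in> ?E"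
        using eq v e0 vN edge_component[OF e0] edge_component[OF vN]
        by (auto simp: mem_component)
      moreover obtain e where "?E = {e}" using m1 unfolding mult_def by (rule card_1_singletonE)
      ultimately have "{p 0, p 1} = {p (3 * r + 4), p (3 * r + 5)}" by (metis singletonD)
      then show False using False no_return[of "3 * r + 5"] by (auto simp: doubleton_eq_iff)
    qed
    moreover have "inj_on p {..3 * r + 5}"
    proof -
      have "p d \<noteq> p 0" if "0 < d" "d < 3 * r + 6" for d
      proof (cases "d = 3 * r + 4")
        case d: False
        then have "d \<le> 3 * r + 3 \<or> d = 3 * r + 5" using that(2) by presburger
        then show ?thesis by (rule no_return[OF that(1)])
      qed (use False in simp)
      then have "inj_on p {..<3 * r + 6}"
        using pow_inj[OF x(1), of "3 * r + 6"] by (simp add: p_def[abs_def])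
      moreover have "{..<3 * r + 6} = {..3 * r + 5}" by auto
      ultimately show ?thesis by simp
    qed
    ultimately show False using no_chain_between_cycles[OF opt ch _ link cv] by blast
  next
    case True
    have "inj_on p {..<3 * r + 4}"
      using pow_inj[OF x(1), of "3 * r + 4"] no_return by (simp add: p_def[abs_def])
    then have inj: "p i = p j \<longleftrightarrow> i = j" if "i < 3 * r + 4" "j < 3 * r + 4" for i j
      using that by (auto simp: inj_on_eq_iff)
    \<comment> \<open>Oddness excludes \<open>r = 0\<close> and \<open>r = 2\<close>. For
      \<open>r = 1\<close> the orbit is the heptagon; for larger \<open>r\<close> three successive
      holes share a component by \<open>holes_around_edge\<close>.\<close>
    have "odd (3 * r + 4)"
      using \<sigma>_odd[OF x(1), of "3 * r + 4"] True \<open>inj_on p {..<3 * r + 4}\<close> by (simp add: p_def[abs_def])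
    then have "r \<noteq> 0" "r \<noteq> 2" by (auto intro: Nat.gr0I)
    then consider "r = 1" | "3 \<le> r" by linarith
    then show False
    proof cases
      case 1
      have "{p 2, p 3} \<in> N" "hole N (p 4)" "{p 5, p 6} \<in> N"
        using edges[of 0] holes[of 0] edges[of 1] 1 by (simp_all add: eval_nat_numeral)
      moreover have "{p 1, p 2} \<in> A" "{p 3, p 4} \<in> A" "{p 4, p 5} \<in> A" "{p 6, p 0} \<in> A"
        using links[of 1] links[of 3] links[of 4] link True 1 by (simp_all add: eval_nat_numeral)
      moreover have "distinct [p 0, p 1, p 2, p 3, p 4, p 5, p 6]" using 1 by (simp add: inj)
      ultimately show False using no_tight_heptagon[OF opt c0] by blast
    next
      case 2
      have h: "hole N (p 4)" "hole N (p 7)" "hole N (p 10)"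
        using holes[of 0] holes[of 1] holes[of 2] 2 by simp_all
      have "{p 5, p 6} \<in> N" "{p 8, p 9} \<in> N" "{p 4, p 5} \<in> A" "{p 6, p 7} \<in> A" "{p 7, p 8} \<in> A" "{p 9, p 10} \<in> A"
        using edges[of 1] edges[of 2] links[of 4] links[of 6] links[of 7] links[of 9] 2 by simp_all
      moreover have "p 4 \<noteq> p 7" "p 7 \<noteq> p 10" "p 4 \<noteq> p 10" using 2 by (simp_all add: inj)
      ultimately show False
        using three_holes[OF adm h] holes_around_edge[OF opt h(1,2)] holes_around_edge[OF opt h(2,3)] by metis
    qed
  qed
qed

text \<open>An edge of \<open>N\<close> brings 1/6 for each end, a hole brings 1/6 but costs 1/2 as the end of a path,
  and an edge of cost 2 and value 1/2 brings 7/12. The bank is a lower bound on what can be carried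
  forward past a token; it depends on whether the token continues an alternating chain that
  starts at a cycle edge.\<close>

definition bank :: "'v \<Rightarrow> real" where
  "bank v = (if wall v then 7 / 12
     else if hole N v then (if tight_hole v then 0 else 1 / 6)
     else if cyclic v then
       (if mult v = 2 \<and> (\<forall>u. token u \<and> cyclic u \<and> next_token u = v \<longrightarrow> wall u) then 1 / 6 else 0)
     else if tight_edge v then 1 / 3 else 1 / 2)"

definition gain :: "'v \<Rightarrow> real" where
  "gain v = (if hole N v then - 1 / 3 else 1 / 3) - (if cyclic v then demand v else 0) +
     (if wall v then 7 / 12 else 0)"

lemma cyclic_not_hole: "cyclic v \<Longrightarrow> \<not> hole N v"
  using hole_no_edge by (auto simp: cyclic_def cycle_edge_def)

lemma token_edge: "token v \<Longrightarrow> \<not> hole N v \<Longrightarrow> {v, \<sigma> v} \<in> N"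
  by (simp add: token_def)

lemma cyclic_token: "cyclic v \<Longrightarrow> token v"
  by (auto simp: cyclic_def token_def cycle_edge_def)

lemma demand_simps:
  "mult v = 2 \<Longrightarrow> demand v = 1 / 2" "3 \<le> mult v \<Longrightarrow> demand v \<le> 1 / 3"
  "1 \<le> mult v \<Longrightarrow> demand v \<le> 5 / 6" "1 \<le> mult v \<Longrightarrow> mult v \<noteq> 1 \<Longrightarrow> demand v \<le> 1 / 2"
  by (auto simp: demand_def divide_simps)

text \<open>Without a wall, successive cycle edges lie on the same cycle. If it has only two edges,
  a third one in a row would have to be one of these two, and the tokens would close up to an orbit
  of length 4.\<close>

lemma two_consecutive_cyclic:
  assumes "cyclic u" "cyclic (next_token u)" "\<not> wall u"
  shows "mult (next_token u) = mult u" "2 \<le> mult u"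
    and "mult u = 2 \<Longrightarrow> token t \<and> cyclic t \<and> next_token t = u \<Longrightarrow> wall t"
proof -
  let ?c = "component (M \<union> N)"
  let ?E = "{e \<in> N. e \<subseteq> ?c u}"
  note c = cyclic_cyclic[OF assms]
  show "mult (next_token u) = mult u" using c by (simp add: mult_def)
  have inE: "{v, \<sigma> v} \<in> ?E" if "cyclic v" "?c v = ?c u" for v
    using that edge_component[of v "\<sigma> v" N] by (auto simp: cyclic_def cycle_edge_def mem_component)
  have ne: "next_token u \<noteq> u"
    using assms(1) \<sigma>_neq2[of u] by (auto simp: next_token_def token_end_def cyclic_def cycle_edge_def)
  have E2: "{{u, \<sigma> u}, {next_token u, \<sigma> (next_token u)}} \<subseteq> ?E" using inE assms(1,2) c by simp
  have card2: "card {{u, \<sigma> u}, {next_token u, \<sigma> (next_token u)}} = 2"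
    using ne \<sigma>_edge_inj assms(1,2) by (auto simp: cyclic_def card_insert_if)
  show "2 \<le> mult u" unfolding mult_def using card_mono[OF _ E2] card2 by simp
  assume m: "mult u = 2" and t: "token t \<and> cyclic t \<and> next_token t = u"
  show "wall t"
  proof (rule ccontr)
    assume "\<not> wall t"
    then have ct: "?c t = ?c u" using cyclic_cyclic[of t] t assms(1) by simp
    have E: "?E = {{u, \<sigma> u}, {next_token u, \<sigma> (next_token u)}}"
      using card_subset_eq[OF _ E2] card2 m by (simp add: mult_def)
    have "{t, \<sigma> t} \<in> ?E" using inE[of t] t ct by simp
    then have "{t, \<sigma> t} = {u, \<sigma> u} \<or> {t, \<sigma> t} = {next_token u, \<sigma> (next_token u)}"
      unfolding E by (simp only: insert_iff empty_iff) simp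
    then have "t = u \<or> t = next_token u" using \<sigma>_edge_inj t assms(1,2) by (auto simp: cyclic_def)
    then have "next_token (next_token u) = u" using t ne by auto
    then show False
      using no_cycle_of_two_edges[of u] assms(1,2) cyclic_token
      by (auto simp: cyclic_def cycle_edge_def)
  qed
qed

text \<open>The values of \<open>bank\<close> come from these balances. Tight stretch: 0 + 1/3 = 1/3
  and 1/3 - 1/3 = 0. Others: 1/2 - 1/3 = 1/6 and 1/6 + 1/3 = 1/2. A single-edge cycle: 1/2 + 1/3 =
  5/6. A cycle with two edges, entered from a tight edge: 1/3 + 1/3 - 1/2 = 1/6, which the second
  edge needs, since 1/6 + 1/3 = 1/2.\<close>

lemma bank_step:
  assumes u: "token u"
  shows "bank (next_token u) \<le> bank u + gain (next_token u)"
proof -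
  let ?v = "next_token u"
  \<comment> \<open>The bank of the next token without its clause for walls. A wall behind that
    token gives 7/12 anew, so it is added back only at the end.\<close>
  define core where "core = (if hole N ?v then (if tight_hole ?v then 0 else 1 / 6)
     else if cyclic ?v then
       (if mult ?v = 2 \<and> (\<forall>u. token u \<and> cyclic u \<and> next_token u = ?v \<longrightarrow> wall u) then 1 / 6 else 0)
     else if tight_edge ?v then 1 / 3 else 1 / 2 :: real)"
  have v: "token ?v" using next_token_token[OF u] .
  have main: "core \<le> bank u + (if hole N ?v then - 1 / 3 else 1 / 3) - (if cyclic ?v then demand ?v else 0)"
  proof (cases "wall u")
    case True
    \<comment> \<open>With the 1/3 of an edge this makes 11/12, which covers even the demand
      5/6.\<close>
    then have b: "bank u = 7 / 12" by (simp add: bank_def)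
    show ?thesis
    proof (cases "cyclic ?v")
      case True
      then show ?thesis
        using b cyclic_not_hole mult_pos[OF True] demand_simps[of ?v] by (auto simp: core_def)
    next
      case False
      then show ?thesis using b by (simp add: core_def)
    qed
  next
    case nw: False
    consider "hole N u" | "cyclic u" | "\<not> hole N u" "\<not> cyclic u" by blast
    then show ?thesis
    proof cases
      case 1
      then have "\<not> hole N ?v" "\<not> cyclic ?v" using no_hole_hole no_hole_cyclic nw by blast+
      then show ?thesis
        using 1 nw tight_hole_edge[of u] token_edge[OF v] by (auto simp: core_def bank_def)
    next
      case 2
      then have nh: "\<not> hole N ?v" "\<not> hole N u" using no_cyclic_hole nw cyclic_not_hole by blast+
      show ?thesis
      proof (cases "cyclic ?v")
        case True
        note tc = two_consecutive_cyclic[OF 2 True nw]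
        have core0: "core = 0" using nh True u 2 nw by (auto simp: core_def)
        consider "mult u = 2" | "3 \<le> mult u" using tc(2) by linarith
        then show ?thesis
        proof cases
          case 1
          then have "bank u = 1 / 6" using 2 nw nh tc(3) by (simp add: bank_def)
          then show ?thesis using core0 nh True 1 tc(1) demand_simps(1)[of ?v] by simp
        next
          case 2
          moreover have "0 \<le> bank u" by (simp add: bank_def)
          ultimately show ?thesis using core0 nh True tc(1) demand_simps(2)[of ?v] by simp
        qed
      next
        case False
        have "tight_edge ?v" using tight_start[OF 2 _ nw] token_edge[OF v nh(1)] by blast
        then show ?thesis using False nh by (simp add: core_def bank_def)
      qed
    next
      case 3
      have b: "bank u = (if tight_edge u then 1 / 3 else 1 / 2)" using 3 nw by (simp add: bank_def)
      show ?thesis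
      proof (cases "cyclic ?v")
        case True
        show ?thesis
        proof (cases "mult ?v = 1")
          case m: True
          then have "\<not> tight_edge u" using tight_edge_cyclic[OF _ 3(2) True nw] by blast
          then show ?thesis
            using b m True cyclic_not_hole[OF True] demand_simps(3)[of ?v] by (simp add: core_def)
        next
          case m: False
          show ?thesis
            using b m True cyclic_not_hole[OF True] mult_pos[OF True] demand_simps(4)[of ?v]
            by (auto simp: core_def)
        qed
      next
        case False
        then show ?thesis using b tight_edge_hole[OF _ _ nw] by (auto simp: core_def)
      qed
    qed
  qed
  have "bank ?v \<le> core + (if wall ?v then 7 / 12 else 0)"
    by (simp add: core_def bank_def)
  then show ?thesis using main by (simp add: gain_def)
qed

text \<open>\<open>next_token\<close> permutes the tokens, so the banks cancel when
  \<open>bank_step\<close> is summed over all of them.\<close>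

lemma gain_sum_nonneg: "0 \<le> (\<Sum>v\<in>{v. token v}. gain v)"
proof -
  have "(\<Sum>v\<in>{v. token v}. bank (next_token v)) \<le> (\<Sum>v\<in>{v. token v}. bank v + gain (next_token v))"
    using bank_step by (intro sum_mono) auto
  also have "\<dots> = (\<Sum>v\<in>{v. token v}. bank v) + (\<Sum>v\<in>{v. token v}. gain v)"
    by (simp add: sum.distrib sum.reindex_bij_betw[OF next_token_bij, of gain])
  finally show ?thesis by (simp add: sum.reindex_bij_betw[OF next_token_bij, of bank])
qed

end

section \<open>From the discharging to the number of components\<close>

context optimal_choice begin

definition cycles :: "'v set set" where
  "cycles = {D \<in> range (component (M \<union> N)). \<forall>u\<in>D. valency (M \<union> N) u = 2}"

abbreviation cycle_tokens :: "'v set \<Rightarrow> 'v set" where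
  "cycle_tokens D \<equiv> {v \<in> U. {v, \<sigma> v} \<in> N \<and> v \<in> D}"

lemma graph_component_closed:
  "e \<in> M \<union> N \<Longrightarrow> e \<inter> component (M \<union> N) v \<noteq> {} \<Longrightarrow> e \<subseteq> component (M \<union> N) v"
  by (rule component_closed[OF graph_edge[OF adm]])

lemma cycle_mem:
  assumes "D \<in> cycles" "v \<in> D"
  shows "D = component (M \<union> N) v"
  using assms by (auto simp: cycles_def mem_component)

lemma token_in_cycle:
  assumes "D \<in> cycles" "v \<in> U" "{v, \<sigma> v} \<in> N" "v \<in> D"
  shows "cyclic v"
proof -
  have "component (M \<union> N - {{v, \<sigma> v}}) v = component (M \<union> N - {{v, \<sigma> v}}) (\<sigma> v)"
    using assms cycle_mem[OF assms(1,4)] \<sigma>_neq[OF assms(2)]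
    by (intro cyclic_component_edge_not_bridge graph_edge[OF adm]) (auto simp: cycles_def)
  moreover have "M \<union> N - {{v, \<sigma> v}} = M \<union> (N - {{v, \<sigma> v}})" using M_A assms(3) NA by auto
  ultimately show ?thesis using assms by (simp add: cyclic_def cycle_edge_def)
qed

lemma card_N: "card {v \<in> U. {v, \<sigma> v} \<in> N} = card N"
proof -
  have "bij_betw (\<lambda>v. {v, \<sigma> v}) {v \<in> U. {v, \<sigma> v} \<in> N} N"
    unfolding bij_betw_def using N_\<sigma> by (auto simp: inj_on_def \<sigma>_edge_inj)
  then show ?thesis by (rule bij_betw_same_card)
qed

lemma card_cycle_tokens:
  assumes "D \<in> cycles" "v \<in> D"
  shows "card (cycle_tokens D) = mult v"
proof -
  have D: "D = component (M \<union> N) v" using cycle_mem[OF assms] .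
  have "bij_betw (\<lambda>v. {v, \<sigma> v}) (cycle_tokens D) {e \<in> N. e \<subseteq> D}"
    unfolding bij_betw_def
  proof
    show "inj_on (\<lambda>v. {v, \<sigma> v}) (cycle_tokens D)" by (auto simp: inj_on_def \<sigma>_edge_inj)
    show "(\<lambda>v. {v, \<sigma> v}) ` cycle_tokens D = {e \<in> N. e \<subseteq> D}"
    proof (intro set_eqI iffI)
      fix e assume "e \<in> (\<lambda>v. {v, \<sigma> v}) ` cycle_tokens D"
      then obtain w where w: "e = {w, \<sigma> w}" "e \<in> N" "w \<in> D" by blast
      then have "e \<subseteq> D" unfolding D by (intro graph_component_closed) auto
      then show "e \<in> {e \<in> N. e \<subseteq> D}" using w by blast
    next
      fix e assume e: "e \<in> {e \<in> N. e \<subseteq> D}"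
      then obtain w where "w \<in> U" "e = {w, \<sigma> w}" using N_\<sigma> by blast
      then show "e \<in> (\<lambda>v. {v, \<sigma> v}) ` cycle_tokens D" using e by blast
    qed
  qed
  then have "card (cycle_tokens D) = card {e \<in> N. e \<subseteq> D}" by (rule bij_betw_same_card)
  then show ?thesis using D by (simp add: mult_def)
qed

text \<open>Without edges of \<open>N\<close>, the cycle would be a component of \<open>M\<close> in
  which every valency is 2, against \<open>M_acyclic\<close>.\<close>

lemma cycle_tokens_nonempty:
  assumes "D \<in> cycles"
  shows "cycle_tokens D \<noteq> {}"
proof
  assume none: "cycle_tokens D = {}"
  obtain v where D: "D = component (M \<union> N) v" using assms by (auto simp: cycles_def)
  have noN: "e \<notin> N" if "e \<inter> D \<noteq> {}" for e
  proof
    assume e: "e \<in> N"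
    then have "e \<subseteq> D" using that graph_component_closed[of e v] D by blast
    then show False using none N_\<sigma>[OF e] e by blast
  qed
  have DM: "D = component M v"
  proof
    show "component M v \<subseteq> D"
      unfolding D component_def using linked_mono[of M v _ "M \<union> N"] by blast
    show "D \<subseteq> component M v"
    proof
      fix u assume "u \<in> D"
      then have "(v, u) \<in> {(a, b). {a, b} \<in> M \<union> N}\<^sup>*" by (simp add: D component_def linked_def)
      then have "u \<in> component M v \<and> u \<in> D"
      proof induction
        case base
        then show ?case by (simp add: D mem_component)
      next
        case (step y z)
        then have "{y, z} \<in> M" using noN[of "{y, z}"] by auto
        then have "component M y = component M z" "component (M \<union> N) y = component (M \<union> N) z"
          using linked_edge linked_iff by (metis, metis UnI1)
        then show ?case using step.IH by (simp add: D mem_component)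
      qed
      then show "u \<in> component M v" by blast
    qed
  qed
  have "valency M u = 2" if "u \<in> D" for u
  proof -
    have "{e \<in> M \<union> N. u \<in> e} = {e \<in> M. u \<in> e}" using noN that by blast
    then show ?thesis using assms that by (auto simp: cycles_def valency_def)
  qed
  then show False using M_acyclic[of v] DM by blast
qed

text \<open>A cycle with a single edge of \<open>N\<close> closes up through edges of \<open>M\<close>, which are disjoint
  from \<open>A\<close>; hence it visits a node with two edges of \<open>M\<close>.\<close>

lemma single_edge_cycle:
  assumes "D \<in> cycles" "card (cycle_tokens D) = 1"
  shows "\<exists>y\<in>D. y \<notin> U"
proof (rule ccontr)
  assume "\<not> ?thesis"
  then have DU: "D \<subseteq> U" by blast
  obtain v where v: "cycle_tokens D = {v}" using assms(2) by (rule card_1_singletonE)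
  then have vD: "v \<in> D" "v \<in> U" "{v, \<sigma> v} \<in> N" by blast+
  have D: "D = component (M \<union> N) v" using cycle_mem[OF assms(1) vD(1)] .
  have "y \<in> {v, \<sigma> v}" if "y \<in> D" for y
  proof (rule ccontr)
    assume y: "y \<notin> {v, \<sigma> v}"
    have "y \<notin> \<Union>N"
    proof
      assume "y \<in> \<Union>N"
      then obtain e where e: "e \<in> N" "y \<in> e" by blast
      then have "e \<subseteq> D" using that graph_component_closed[of e v] D by blast
      moreover obtain w where "w \<in> U" "e = {w, \<sigma> w}" using N_\<sigma>[OF e(1)] by blast
      ultimately have "w \<in> cycle_tokens D" using e by blast
      then have "w = v" using v by (metis singletonD)
      then show False using y e \<open>e = {w, \<sigma> w}\<close> by simp
    qed
    then have "hole N y" using DU that by (auto simp: hole_def)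
    then show False using hole_valency[OF adm, of y] assms(1) that by (auto simp: cycles_def)
  qed
  then have two: "D \<subseteq> {v, \<sigma> v}" by blast
  have "{e \<in> M \<union> N. v \<in> e} \<subseteq> {{v, \<sigma> v}}"
  proof
    fix e assume e: "e \<in> {e \<in> M \<union> N. v \<in> e}"
    then have "e \<subseteq> D" using graph_component_closed[of e v] D vD(1) by blast
    then have "e \<subseteq> {v, \<sigma> v}" "card e = 2" using two graph_edge[OF adm, of e] e by auto
    then have "e = {v, \<sigma> v}" using \<sigma>_neq[OF vD(2)] by (intro card_subset_eq) auto
    then show "e \<in> {{v, \<sigma> v}}" by simp
  qed
  then have "valency (M \<union> N) v \<le> card {{v, \<sigma> v}}" unfolding valency_def by (rule card_mono[rotated]) simp
  then show False using assms(1) vD(1) by (auto simp: cycles_def)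
qed

lemma cycles_disjoint: "D \<in> cycles \<Longrightarrow> D' \<in> cycles \<Longrightarrow> x \<in> D \<Longrightarrow> x \<in> D' \<Longrightarrow> D = D'"
  using cycle_mem by metis

text \<open>The demands on a cycle add up to 1, or to 5/6 if it has a single edge. In the latter
  case the missing 1/6 is charged to a node outside \<open>U\<close>; cycles are disjoint, so no
  node is charged twice.\<close>

lemma cycles_bound:
  "real (card cycles) \<le> real (card (- U)) / 6 + (\<Sum>v | cyclic v. demand v)"
proof -
  let ?S = "{D \<in> cycles. card (cycle_tokens D) = 1}"
  have "\<forall>D\<in>?S. \<exists>y. y \<in> D \<and> y \<notin> U" using single_edge_cycle by blast
  from bchoice[OF this] obtain f where f': "\<forall>D\<in>?S. f D \<in> D \<and> f D \<notin> U" by blast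
  then have f: "f D \<in> D \<and> f D \<notin> U" if "D \<in> ?S" for D using that by (rule bspec)
  have "inj_on f ?S"
  proof (rule inj_onI)
    fix D D' assume *: "D \<in> ?S" "D' \<in> ?S" "f D = f D'"
    then have "f D \<in> D" "f D \<in> D'" using f[of D] f[of D'] by simp_all
    then show "D = D'" using * cycles_disjoint[of D D' "f D"] by simp
  qed
  moreover have "f ` ?S \<subseteq> - U" using f by blast
  ultimately have S: "card ?S \<le> card (- U)" by (intro card_inj_on_le) auto
  have each: "(\<Sum>v\<in>cycle_tokens D. demand v) = 1 - (if card (cycle_tokens D) = 1 then 1 / 6 else 0)"
    if D: "D \<in> cycles" for D
  proof -
    let ?k = "card (cycle_tokens D)"
    have k: "?k \<noteq> 0" using cycle_tokens_nonempty[OF D] by simp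
    have "(\<Sum>v\<in>cycle_tokens D. demand v) = (\<Sum>v\<in>cycle_tokens D. if ?k = 1 then 5 / 6 else 1 / real ?k)"
      using card_cycle_tokens[OF D] by (intro sum.cong) (auto simp: demand_def)
    also have "\<dots> = 1 - (if ?k = 1 then 1 / 6 else 0)"
      using k by (cases "?k = 1") (simp_all del: card_0_eq)
    finally show ?thesis .
  qed
  have "real (card cycles) - real (card ?S) / 6 =
      (\<Sum>D\<in>cycles. 1 - (if card (cycle_tokens D) = 1 then 1 / 6 else 0))"
    by (simp add: sum_subtractf sum.If_cases Int_def)
  also have "\<dots> = (\<Sum>D\<in>cycles. \<Sum>v\<in>cycle_tokens D. demand v)"
    using each by (intro sum.cong) auto
  also have "\<dots> = (\<Sum>v\<in>(\<Union>D\<in>cycles. cycle_tokens D). demand v)"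
    using cycles_disjoint by (intro sum.UNION_disjoint[symmetric]) auto
  also have "\<dots> \<le> (\<Sum>v | cyclic v. demand v)"
    using token_in_cycle by (intro sum_mono2) (auto simp: demand_def)
  finally show ?thesis using S by simp
qed

text \<open>By the handshake identity, a component on m nodes has m edges if it is a cycle and at
  most m - 1 otherwise.\<close>

lemma components_bound:
  "num_components (M \<union> N) + card M + card N \<le> CARD('v) + card cycles"
proof -
  let ?F = "M \<union> N"
  let ?E = "\<lambda>D. {e \<in> ?F. e \<subseteq> D}"
  let ?R = "range (component ?F)"
  have each: "card (?E D) + 1 \<le> card D + (if D \<in> cycles then 1 else 0)" if D: "D \<in> ?R" for D
  proof -
    obtain v where v: "D = component ?F v" using D by blast
    have hs: "(\<Sum>u\<in>D. valency ?F u) = 2 * card (?E D)"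
      using graph_edge[OF adm] graph_component_closed v by (intro handshake) blast+
    have le: "(\<Sum>u\<in>D. valency ?F u) \<le> (\<Sum>u\<in>D. 2)"
      using graph_valency[OF adm] by (intro sum_mono) auto
    show ?thesis
    proof (cases "D \<in> cycles")
      case False
      then obtain u where "u \<in> D" "valency ?F u \<noteq> 2" using D by (auto simp: cycles_def)
      then have "(\<Sum>u\<in>D. valency ?F u) < (\<Sum>u\<in>D. 2)"
        using graph_valency[OF adm] by (intro sum_strict_mono_ex1) (auto simp: order_le_less)
      then show ?thesis using hs False by simp
    qed (use hs le in simp)
  qed
  have disj: "D \<inter> D' = {}" if "D \<in> ?R" "D' \<in> ?R" "D \<noteq> D'" for D D'
    using that by (auto simp: mem_component)
  have "?F = (\<Union>D\<in>?R. ?E D)"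
  proof
    show "?F \<subseteq> (\<Union>D\<in>?R. ?E D)"
    proof
      fix e assume e: "e \<in> ?F"
      then obtain v where "v \<in> e" using graph_edge[OF adm e] by fastforce
      then have "e \<inter> component ?F v \<noteq> {}" by (auto simp: mem_component)
      then show "e \<in> (\<Union>D\<in>?R. ?E D)" using graph_component_closed[OF e] e by blast
    qed
  qed blast
  then have "card ?F = card (\<Union>D\<in>?R. ?E D)" by simp
  also have "\<dots> = (\<Sum>D\<in>?R. card (?E D))"
  proof (rule card_UN_disjoint)
    show "\<forall>D\<in>?R. \<forall>D'\<in>?R. D \<noteq> D' \<longrightarrow> ?E D \<inter> ?E D' = {}"
    proof (intro ballI impI)
      fix D D' assume D: "D \<in> ?R" "D' \<in> ?R" "D \<noteq> D'"
      show "?E D \<inter> ?E D' = {}"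
      proof (rule ccontr)
        assume "\<not> ?thesis"
        then obtain e where e: "e \<in> ?F" "e \<subseteq> D" "e \<subseteq> D'" by blast
        then have "e = {}" using disj[OF D] by blast
        then show False using graph_edge[OF adm e(1)] by simp
      qed
    qed
  qed auto
  finally have F: "card ?F = (\<Sum>D\<in>?R. card (?E D))" .
  have "UNIV = \<Union>?R" by (auto simp: mem_component)
  then have "CARD('v) = card (\<Union>?R)" by simp
  also have "\<dots> = (\<Sum>D\<in>?R. card D)"
    using disj by (intro card_Union_disjoint) (auto simp: pairwise_def disjnt_def)
  finally have V: "CARD('v) = (\<Sum>D\<in>?R. card D)" .
  have "cycles = ?R \<inter> cycles" by (auto simp: cycles_def)
  then have "(\<Sum>D\<in>?R. if D \<in> cycles then 1 else 0) = card cycles"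
    by (simp add: sum.If_cases Int_def)
  moreover have "(\<Sum>D\<in>?R. card (?E D) + 1) \<le> (\<Sum>D\<in>?R. card D + (if D \<in> cycles then 1 else 0))"
    by (rule sum_mono) (rule each)
  ultimately have "card ?F + num_components ?F \<le> CARD('v) + card cycles"
    using F V by (simp only: sum.distrib num_components_def) simp
  moreover have "card ?F = card M + card N"
    using M_A NA by (intro card_Un_disjoint) auto
  ultimately show ?thesis by simp
qed

text \<open>Edges and holes contribute (|N| - h)/3 to the total gain for h holes, and |U| \<le> h +
  2|N| turns this into the first summand. By \<open>token_end_inj\<close>, different walls use
  different half edges.\<close>

lemma demand_bound:
  "(\<Sum>v | cyclic v. demand v) \<le> (3 * real (card N) - real (card U)) / 3 +
     7 / 12 * real (card {v \<in> U. {v, \<sigma> v} \<notin> A})"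
proof -
  let ?T = "{v. token v}" and ?H = "{v. hole N v}"
  have T: "?T = {v \<in> U. {v, \<sigma> v} \<in> N} \<union> ?H" "{v \<in> U. {v, \<sigma> v} \<in> N} \<inter> ?H = {}"
    using hole_no_edge by (auto simp: token_def hole_def)
  have "(\<Sum>v\<in>?T. if hole N v then - 1 / 3 else 1 / 3) = (real (card N) - real (card ?H)) / 3"
  proof -
    have "(\<Sum>v\<in>?T. if hole N v then - 1 / 3 else 1 / 3 :: real) =
        (\<Sum>v\<in>{v \<in> U. {v, \<sigma> v} \<in> N}. if hole N v then - 1 / 3 else 1 / 3) +
        (\<Sum>v\<in>?H. if hole N v then - 1 / 3 else 1 / 3)"
      unfolding T(1) using T(2) by (intro sum.union_disjoint) auto
    also have "(\<Sum>v\<in>{v \<in> U. {v, \<sigma> v} \<in> N}. if hole N v then - 1 / 3 else 1 / 3 :: real) =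
        (\<Sum>v\<in>{v \<in> U. {v, \<sigma> v} \<in> N}. 1 / 3)"
      using T(2) by (intro sum.cong) auto
    finally show ?thesis by (simp add: card_N diff_divide_distrib)
  qed
  moreover have "(\<Sum>v\<in>?T. if cyclic v then demand v else 0) = (\<Sum>v | cyclic v. demand v)"
  proof -
    have "?T \<inter> {v. cyclic v} = {v. cyclic v}" using cyclic_token by blast
    then show ?thesis by (simp add: sum.If_cases)
  qed
  moreover have "(\<Sum>v\<in>?T. if wall v then 7 / 12 else 0 :: real) \<le> 7 / 12 * real (card {v \<in> U. {v, \<sigma> v} \<notin> A})"
  proof -
    have "inj_on token_end {v. token v \<and> wall v}" using token_end_inj by (rule inj_on_subset) auto
    moreover have "token_end ` {v. token v \<and> wall v} \<subseteq> {v \<in> U. {v, \<sigma> v} \<notin> A}"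
      using token_end_U by (auto simp: wall_def)
    ultimately have "card {v. token v \<and> wall v} \<le> card {v \<in> U. {v, \<sigma> v} \<notin> A}"
      by (intro card_inj_on_le) auto
    then show ?thesis by (simp add: sum.If_cases Int_def)
  qed
  moreover have "real (card U) \<le> real (card ?H) + 2 * real (card N)"
  proof -
    have "U \<subseteq> ?H \<union> \<Union>N" by (auto simp: hole_def)
    then have "card U \<le> card (?H \<union> \<Union>N)" by (intro card_mono) auto
    also have "\<dots> \<le> card ?H + card (\<Union>N)" by (rule card_Un_le)
    also have "card (\<Union>N) \<le> (\<Sum>e\<in>N. card e)" by (rule card_Union_le_sum_card)
    also have "\<dots> = 2 * card N" using NA A_edge by (subst sum.cong[OF refl, of N card "\<lambda>_. 2"]) auto
    finally show ?thesis by linarith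
  qed
  moreover have "0 \<le> (\<Sum>v\<in>?T. if hole N v then - 1 / 3 else 1 / 3) -
      (\<Sum>v\<in>?T. if cyclic v then demand v else 0) + (\<Sum>v\<in>?T. if wall v then 7 / 12 else 0)"
    using gain_sum_nonneg unfolding gain_def by (simp only: sum.distrib sum_subtractf)
  \<comment> \<open>The sums are abstracted to real variables, which leaves plain linear
    arithmetic.\<close>
  moreover have "s \<le> (3 * n - u) / 3 + b"
    if "a = (n - h) / 3" "c = s" "d \<le> b" "u \<le> h + 2 * n" "0 \<le> a - c + d" for a b c d h n s u :: real
    using that by argo
  ultimately show ?thesis by blast
qed

text \<open>The number of edges in \<open>N\<close> cancels between \<open>components_bound\<close>
  and \<open>demand_bound\<close>, and the 1/6 for each node outside \<open>U\<close> raises n to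
  7n/6.\<close>

lemma optimal_components_bound:
  "real (num_components (M \<union> N)) \<le> 7 / 6 * CARD('v) - card M - real (card U) / 2 +
     7 / 12 * card {v \<in> U. {v, \<sigma> v} \<notin> A}"
proof -
  have "card (- U) + card U = CARD('v)"
    using card_Un_disjoint[of "- U" U] by (simp add: Un_commute)
  then have "real (card (- U)) = CARD('v) - real (card U)" by linarith
  moreover have "real (num_components (M \<union> N)) + card M + card N \<le> CARD('v) + real (card cycles)"
    using components_bound by linarith
  ultimately show ?thesis using cycles_bound demand_bound by (simp add: field_simps)
qed

end

section \<open>Extreme points of the two-matching polytope\<close>

definition fractional_edges :: "real ^ ('v::finite set) \<Rightarrow> 'v set set" where
  "fractional_edges x = {e \<in> complete_edges. 0 < x $ e \<and> x $ e < 1}"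

definition full_edges :: "real ^ ('v::finite set) \<Rightarrow> 'v set set" where
  "full_edges x = {e \<in> complete_edges. x $ e = 1}"

text \<open>Along a balanced direction supported on fractional edges one can move a little both ways
  inside the polytope, and \<open>x\<close> would be a midpoint.\<close>

lemma extreme_point_rigid:
  fixes x d :: "real ^ ('v::finite set)"
  assumes "fractional_2_matching x" and supp: "\<And>e. e \<notin> fractional_edges x \<Longrightarrow> d $ e = 0"
    and bal: "\<And>i. (\<Sum>e\<in>incident_edges i. d $ e) = 0"
  shows "d = 0"
proof (rule ccontr)
  assume d0: "d \<noteq> 0"
  let ?P = "two_matching_polytope :: (real ^ ('v set)) set"
  have x: "x \<in> ?P" "\<And>a b. a \<in> ?P \<Longrightarrow> b \<in> ?P \<Longrightarrow> x \<notin> open_segment a b"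
    using assms(1) by (auto simp: fractional_2_matching_def extreme_point_of_def)
  \<comment> \<open>The summand 1 in the denominator covers edges with \<open>d $ e = 0\<close>; the
    1 inserted below covers an empty set of fractional edges.\<close>
  let ?m = "\<lambda>e. min (x $ e) (1 - x $ e) / (1 + \<bar>d $ e\<bar>)"
  define t where "t = Min (insert 1 (?m ` fractional_edges x))"
  have t0: "0 < t" unfolding t_def by (subst Min_gr_iff) (auto simp: fractional_edges_def)
  have step: "\<bar>t * d $ e\<bar> \<le> min (x $ e) (1 - x $ e)" if "e \<in> fractional_edges x" for e
  proof -
    have "t \<le> ?m e" unfolding t_def using that by (intro Min_le) auto
    then have "t * (1 + \<bar>d $ e\<bar>) \<le> min (x $ e) (1 - x $ e)" by (simp add: pos_le_divide_eq)
    then show ?thesis using t0 by (simp add: abs_mult algebra_simps)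
  qed
  have inP: "x + s *\<^sub>R d \<in> ?P" if s: "s = t \<or> s = - t" for s
    unfolding two_matching_polytope_def
  proof (intro CollectI conjI allI ballI impI)
    fix i
    show "(\<Sum>e\<in>incident_edges i. (x + s *\<^sub>R d) $ e) = 2"
      using x(1) bal by (simp add: two_matching_polytope_def sum.distrib flip: sum_distrib_left)
  next
    fix e :: "'v set" assume e: "e \<in> complete_edges"
    have "0 \<le> (x + s *\<^sub>R d) $ e \<and> (x + s *\<^sub>R d) $ e \<le> 1"
    proof (cases "e \<in> fractional_edges x")
      case True
      then show ?thesis using step[OF True] s by auto
    next
      case False
      then show ?thesis using x(1) supp e by (simp add: two_matching_polytope_def)
    qed
    then show "0 \<le> (x + s *\<^sub>R d) $ e" "(x + s *\<^sub>R d) $ e \<le> 1" by auto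
  next
    fix e :: "'v set" assume e: "e \<notin> complete_edges"
    then have "d $ e = 0" using supp by (simp add: fractional_edges_def)
    then show "(x + s *\<^sub>R d) $ e = 0" using x(1) e by (simp add: two_matching_polytope_def)
  qed
  have "x + t *\<^sub>R d \<noteq> x + (- t) *\<^sub>R d"
    using d0 t0 by (simp add: vec_eq_iff)
  then have "midpoint (x + t *\<^sub>R d) (x + (- t) *\<^sub>R d) \<in> open_segment (x + t *\<^sub>R d) (x + (- t) *\<^sub>R d)"
    by (simp only: midpoint_in_open_segment) simp
  moreover have "midpoint (x + t *\<^sub>R d) (x + (- t) *\<^sub>R d) = x"
    by (simp add: midpoint_def flip: scaleR_2)
  ultimately show False using x(2)[OF inP[of t] inP[of "- t"]] by metis
qed

lemma incident_sum:
  fixes x :: "real ^ ('v::finite set)"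
  assumes "x \<in> two_matching_polytope"
  shows "(\<Sum>e | e \<in> fractional_edges x \<and> i \<in> e. x $ e) + real (valency (full_edges x) i) = 2"
proof -
  let ?I = "incident_edges i"
  have I: "?I = {e \<in> fractional_edges x. i \<in> e} \<union> {e \<in> full_edges x. i \<in> e} \<union> {e \<in> ?I. x $ e = 0}"
    using assms by (force simp: incident_edges_def fractional_edges_def full_edges_def two_matching_polytope_def)
  have "2 = (\<Sum>e\<in>?I. x $ e)" using assms by (simp add: two_matching_polytope_def)
  also have "\<dots> = (\<Sum>e\<in>{e \<in> fractional_edges x. i \<in> e} \<union> {e \<in> full_edges x. i \<in> e}. x $ e) + (\<Sum>e | e \<in> ?I \<and> x $ e = 0. x $ e)"
    by (subst I, subst sum.union_disjoint) (auto simp: fractional_edges_def full_edges_def)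
  also have "(\<Sum>e | e \<in> ?I \<and> x $ e = 0. x $ e) = 0" by (intro sum.neutral) auto
  also have "(\<Sum>e\<in>{e \<in> fractional_edges x. i \<in> e} \<union> {e \<in> full_edges x. i \<in> e}. x $ e) =
      (\<Sum>e\<in>{e \<in> fractional_edges x. i \<in> e}. x $ e) + (\<Sum>e\<in>{e \<in> full_edges x. i \<in> e}. x $ e)"
    by (subst sum.union_disjoint) (auto simp: fractional_edges_def full_edges_def)
  also have "(\<Sum>e\<in>{e \<in> full_edges x. i \<in> e}. x $ e) = (\<Sum>e\<in>{e \<in> full_edges x. i \<in> e}. 1)"
    by (intro sum.cong) (auto simp: full_edges_def)
  finally show ?thesis by (simp add: valency_def)
qed

text \<open>Full edges contribute an integer to the total 2 at a node, and a single fractional value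
  cannot supply the rest.\<close>

lemma valency_fractional_not_1:
  fixes x :: "real ^ ('v::finite set)"
  assumes "x \<in> two_matching_polytope"
  shows "valency (fractional_edges x) i \<noteq> 1"
proof
  assume "valency (fractional_edges x) i = 1"
  then obtain e where e: "{e \<in> fractional_edges x. i \<in> e} = {e}"
    unfolding valency_def by (rule card_1_singletonE)
  then have "e \<in> fractional_edges x" by blast
  then have b: "0 < x $ e" "x $ e < 1" by (auto simp: fractional_edges_def)
  have "x $ e + real (valency (full_edges x) i) = 2" using incident_sum[OF assms, of i] e by simp
  then have "real (valency (full_edges x) i) < real 2" "real 1 < real (valency (full_edges x) i)"
    using b by auto
  then have "valency (full_edges x) i < 2" "1 < valency (full_edges x) i"
    by (simp_all only: of_nat_less_iff)
  then show False by simp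
qed

text \<open>Rigidity makes the fractional edges linearly independent in the space of nodes they
  touch, so there are at most as many of them as nodes; since every such node has at least
  two of them, it has exactly two.\<close>

lemma card_fractional_edges_le:
  fixes x :: "real ^ ('v::finite set)"
  assumes "fractional_2_matching x"
  shows "card (fractional_edges x) \<le> card {i. valency (fractional_edges x) i \<noteq> 0}"
proof -
  let ?S = "{d :: real ^ ('v set). \<forall>e. e \<notin> fractional_edges x \<longrightarrow> d $ e = 0}"
  let ?V = "{i. valency (fractional_edges x) i \<noteq> 0}"
  define f :: "real ^ ('v set) \<Rightarrow> real ^ 'v" where "f d = (\<chi> i. \<Sum>e\<in>incident_edges i. d $ e)" for d
  have lin: "linear f"
    by (rule linearI) (simp_all add: f_def vec_eq_iff sum.distrib sum_distrib_left)
  have sub: "subspace ?S" by (simp add: subspace_def)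
  have "inj_on f ?S"
    unfolding linear_injective_on_subspace_0[OF lin sub]
  proof (intro ballI impI)
    fix d assume d: "d \<in> ?S" "f d = 0"
    then have "(\<Sum>e\<in>incident_edges i. d $ e) = 0" for i by (simp add: f_def vec_eq_iff)
    then show "d = 0" using extreme_point_rigid[OF assms, of d] d(1) by blast
  qed
  moreover have "span ?S = ?S" using sub by (simp only: span_eq_iff)
  ultimately have "dim (f ` ?S) = dim ?S" using lin by (intro dim_image_eq) (simp_all only:)
  moreover have "dim ?S = card (fractional_edges x)"
    using dim_substandard_cart[of "fractional_edges x", where 'a = real] by (simp add: dim_vec_eq)
  moreover have "f ` ?S \<subseteq> {y :: real ^ 'v. \<forall>i. i \<notin> ?V \<longrightarrow> y $ i = 0}"
  proof (intro image_subsetI CollectI allI impI)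
    fix d i
    assume d: "d \<in> ?S" and "i \<notin> ?V"
    then have "{e \<in> fractional_edges x. i \<in> e} = {}" by (simp add: valency_def)
    then have "d $ e = 0" if "e \<in> incident_edges i" for e
      using d that by (auto simp: incident_edges_def)
    then show "f d $ i = 0" by (simp add: f_def)
  qed
  then have "dim (f ` ?S) \<le> dim {y :: real ^ 'v. \<forall>i. i \<notin> ?V \<longrightarrow> y $ i = 0}" by (rule dim_subset)
  moreover have "dim {y :: real ^ 'v. \<forall>i. i \<notin> ?V \<longrightarrow> y $ i = 0} = card ?V"
    using dim_substandard_cart[of ?V, where 'a = real] by (simp add: dim_vec_eq)
  ultimately show ?thesis by simp
qed

lemma valency_fractional:
  fixes x :: "real ^ ('v::finite set)"
  assumes "fractional_2_matching x" "valency (fractional_edges x) i \<noteq> 0"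
  shows "valency (fractional_edges x) i = 2"
proof (rule ccontr)
  assume n: "valency (fractional_edges x) i \<noteq> 2"
  let ?V = "{i. valency (fractional_edges x) i \<noteq> 0}"
  have xP: "x \<in> two_matching_polytope"
    using assms(1) by (simp add: fractional_2_matching_def extreme_point_of_def)
  have ge: "2 \<le> valency (fractional_edges x) j" if "j \<in> ?V" for j
    using valency_fractional_not_1[OF xP, of j] that by auto
  have "2 * card ?V = (\<Sum>j\<in>?V. 2)" by simp
  also have "\<dots> < (\<Sum>j\<in>?V. valency (fractional_edges x) j)"
    using ge assms(2) n by (intro sum_strict_mono_ex1) (auto simp: order_le_less)
  also have "\<dots> = (\<Sum>j\<in>UNIV. valency (fractional_edges x) j)"
    by (intro sum.mono_neutral_left) auto
  also have "\<dots> = 2 * card {e \<in> fractional_edges x. e \<subseteq> UNIV}"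
    by (intro handshake) (auto simp: fractional_edges_def complete_edges_def)
  finally show False using card_fractional_edges_le[OF assms(1)] by simp
qed

text \<open>Two fractional values at a node have a sum strictly between 0 and 2 that is also an
  integer, hence 1. So the deviation from 1/2 is a balanced direction and vanishes by
  rigidity.\<close>

lemma fractional_half:
  fixes x :: "real ^ ('v::finite set)"
  assumes "fractional_2_matching x" "e \<in> fractional_edges x"
  shows "x $ e = 1 / 2"
proof -
  have xP: "x \<in> two_matching_polytope"
    using assms(1) by (simp add: fractional_2_matching_def extreme_point_of_def)
  define d :: "real ^ ('v set)" where "d = (\<chi> e. if e \<in> fractional_edges x then x $ e - 1 / 2 else 0)"
  have "d = 0"
  proof (rule extreme_point_rigid[OF assms(1)])
    fix i
    let ?I = "{e \<in> fractional_edges x. i \<in> e}"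
    have "(\<Sum>e\<in>incident_edges i. d $ e) = (\<Sum>e\<in>?I. x $ e - 1 / 2)"
      unfolding d_def by (simp add: sum.If_cases)
        (intro sum.cong, auto simp: incident_edges_def fractional_edges_def)
    also have "\<dots> = (\<Sum>e\<in>?I. x $ e) - real (valency (fractional_edges x) i) / 2"
      by (simp add: sum_subtractf valency_def)
    also have "\<dots> = 0"
    proof (cases "valency (fractional_edges x) i = 0")
      case True
      then have "?I = {}" by (simp add: valency_def)
      then show ?thesis using True by (simp only:) simp
    next
      case False
      then have two: "card ?I = 2" using valency_fractional[OF assms(1) False] by (simp add: valency_def)
      then have ne: "?I \<noteq> {}" by (metis card.empty zero_neq_numeral)
      have "(\<Sum>e\<in>?I. x $ e) < (\<Sum>e\<in>?I. 1)" "(\<Sum>e\<in>?I. 0) < (\<Sum>e\<in>?I. x $ e)"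
        using ne by (intro sum_strict_mono; auto simp: fractional_edges_def)+
      then have "(\<Sum>e\<in>?I. x $ e) < 2" "0 < (\<Sum>e\<in>?I. x $ e)" using two by simp_all
      then have "real 0 < real (valency (full_edges x) i)" "real (valency (full_edges x) i) < real 2"
        using incident_sum[OF xP, of i] by simp_all
      then have "valency (full_edges x) i = 1" by (simp only: of_nat_less_iff)
      then show ?thesis using incident_sum[OF xP, of i] valency_fractional[OF assms(1) False] by simp
    qed
    finally show "(\<Sum>e\<in>incident_edges i. d $ e) = 0" .
  qed (simp add: d_def)
  then have "d $ e = 0" by simp
  then show ?thesis using assms(2) by (simp add: d_def)
qed

section \<open>Orientation and parity of the fractional cycles\<close>

text \<open>The Hamiltonian path of each component closes up, and \<open>\<sigma>\<close> is the
  cyclic shift of positions. The lists are chosen for components rather than nodes, so that all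
  nodes of a cycle agree on its direction.\<close>

lemma cyclic_successor_exists:
  fixes F :: "'v::finite set set"
  assumes edges: "\<And>e. e \<in> F \<Longrightarrow> card e = 2" and reg: "\<And>v. valency F v \<noteq> 0 \<Longrightarrow> valency F v = 2"
  defines "U \<equiv> {v. valency F v \<noteq> 0}"
  shows "\<exists>\<sigma>. bij_betw \<sigma> U U \<and> (\<forall>v\<in>U. {v, \<sigma> v} \<in> F \<and> \<sigma> v \<noteq> v \<and> \<sigma> (\<sigma> v) \<noteq> v) \<and>
    (\<forall>e\<in>F. \<exists>v\<in>U. e = {v, \<sigma> v})"
proof -
  have deg: "valency F v \<le> 2" for v using reg[of v] by (cases "valency F v = 0") auto
  have inU: "a \<in> U" if "{a, b} \<in> F" for a b
  proof -
    have "{e \<in> F. a \<in> e} \<noteq> {}" using that by blast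
    then show ?thesis by (simp add: U_def valency_def)
  qed
  have "\<forall>D\<in>range (component F). \<exists>vs. walk F vs \<and> set vs = D \<and> vs \<noteq> []"
    using component_hamiltonian_path[OF edges deg] by blast
  from bchoice[OF this] obtain L where
    "\<forall>D\<in>range (component F). walk F (L D) \<and> set (L D) = D \<and> L D \<noteq> []" by blast
  then have L: "walk F (L (component F v))" "set (L (component F v)) = component F v" "L (component F v) \<noteq> []"
    for v by auto
  define l where "l v = L (component F v)" for v
  define k where "k v = (SOME i. i < length (l v) \<and> l v ! i = v)" for v
  have k: "k v < length (l v)" "l v ! k v = v" for v
  proof -
    have "v \<in> set (l v)" using L(2)[of v] by (simp add: l_def mem_component)
    then have "\<exists>i. i < length (l v) \<and> l v ! i = v" by (simp add: in_set_conv_nth)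
    then have "k v < length (l v) \<and> l v ! k v = v" unfolding k_def by (rule someI_ex)
    then show "k v < length (l v)" "l v ! k v = v" by auto
  qed
  define \<sigma> where "\<sigma> v = l v ! (Suc (k v) mod length (l v))" for v
  have dist: "distinct (l v)" for v using L(1) by (simp add: l_def walk_def)
  have len0: "0 < length (l v)" for v using L(3) by (simp add: l_def)
  have comp\<sigma>: "component F (\<sigma> v) = component F v" for v
  proof -
    have "\<sigma> v \<in> set (l v)" unfolding \<sigma>_def using len0 by (intro nth_mem) simp
    then show ?thesis using L(2)[of v] by (simp add: l_def mem_component)
  qed
  then have l\<sigma>: "l (\<sigma> v) = l v" for v by (simp add: l_def)
  have k\<sigma>: "k (\<sigma> v) = Suc (k v) mod length (l v)" for v
    using k[of "\<sigma> v"] l\<sigma>[of v] dist[of v] len0[of v]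
    by (simp add: \<sigma>_def nth_eq_iff_index_eq)
  have compU: "u \<in> U" if "v \<in> U" "component F u = component F v" for u v
  proof -
    have "(v, u) \<in> {(a, b). {a, b} \<in> F}\<^sup>*"
      using linked_iff[of F v u] that(2) by (simp add: linked_def)
    then show ?thesis
    proof (cases rule: rtranclE)
      case (step y)
      then show ?thesis using inU[of u y] by (simp add: insert_commute)
    qed (use that in simp)
  qed
  have close: "3 \<le> length (l v)" "{l v ! (length (l v) - 1), l v ! 0} \<in> F" if "v \<in> U" for v
  proof -
    have "valency F u = 2" if "u \<in> set (l v)" for u
      using compU[OF \<open>v \<in> U\<close>, of u] that L(2)[of v] reg[of u] by (simp add: l_def mem_component U_def)
    then show "3 \<le> length (l v)" "{l v ! (length (l v) - 1), l v ! 0} \<in> F"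
      using walk_closes[OF edges deg L(1)[of v] L(2)[of v]] L(3)[of v] by (auto simp: l_def)
  qed
  have \<sigma>U: "\<sigma> v \<in> U" if "v \<in> U" for v using compU[OF that comp\<sigma>] .
  have \<sigma>F: "{v, \<sigma> v} \<in> F" if "v \<in> U" for v
  proof (cases "Suc (k v) = length (l v)")
    case True
    then have "k v = length (l v) - 1" by simp
    then show ?thesis using close(2)[OF that] k[of v] True by (simp add: \<sigma>_def)
  next
    case False
    then have "Suc (k v) < length (l v)" using k(1)[of v] by simp
    then have "{l v ! k v, l v ! Suc (k v)} \<in> F" using L(1)[of v] by (simp add: l_def walk_def)
    then show ?thesis using k(2)[of v] \<open>Suc (k v) < length (l v)\<close> by (simp add: \<sigma>_def)
  qed
  have \<sigma>1: "\<sigma> v \<noteq> v" if "v \<in> U" for v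
    using \<sigma>F[OF that] edges by fastforce
  have \<sigma>2: "\<sigma> (\<sigma> v) \<noteq> v" if "v \<in> U" for v
  proof
    assume "\<sigma> (\<sigma> v) = v"
    then have "Suc (Suc (k v) mod length (l v)) mod length (l v) = k v"
      using k\<sigma>[of "\<sigma> v"] k\<sigma>[of v] l\<sigma>[of v] by simp
    then show False using k(1)[of v] close(1)[OF that] by (auto simp: mod_Suc split: if_splits)
  qed
  have inj: "inj_on \<sigma> U"
  proof (rule inj_onI)
    fix u v assume uv: "u \<in> U" "v \<in> U" "\<sigma> u = \<sigma> v"
    then have luv: "l u = l v" using l\<sigma> by metis
    have "Suc (k u) mod length (l v) = Suc (k v) mod length (l v)"
      using k\<sigma>[of u] k\<sigma>[of v] uv(3) luv by simp
    then have "k u = k v"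
      using k(1)[of u] k(1)[of v] luv by (auto simp: mod_Suc split: if_splits)
    then show "u = v" using k(2)[of u] k(2)[of v] luv by metis
  qed
  have bij: "bij_betw \<sigma> U U"
    using inj \<sigma>U by (simp add: bij_betw_def endo_inj_surj image_subsetI)
  moreover have "\<exists>v\<in>U. e = {v, \<sigma> v}" if e: "e \<in> F" for e
  proof -
    obtain a b where ab: "e = {a, b}" using edges[OF e] by (meson card_2_iff)
    have a: "a \<in> U" using inU e ab by blast
    then obtain p where p: "p \<in> U" "a = \<sigma> p" using bij by (auto simp: bij_betw_def)
    have "b = \<sigma> a \<or> b = p"
    proof (rule ccontr)
      assume n: "\<not> ?thesis"
      have "{a, p} \<in> F" using \<sigma>F[OF p(1)] p(2) by (simp add: insert_commute)
      then have "3 \<le> valency F a"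
        using three_neighbours[of a "\<sigma> a" F p b] \<sigma>F[OF a] e ab n \<sigma>2[OF p(1)] p(2) by auto
      then show False using deg[of a] by simp
    qed
    then show ?thesis using a p ab by (auto simp: insert_commute)
  qed
  ultimately show ?thesis using \<sigma>F \<sigma>1 \<sigma>2 by (intro exI[of _ \<sigma>]) simp
qed

text \<open>On a closed walk of even length, the alternating vector would be a balanced direction.\<close>

lemma fractional_cycle_odd:
  fixes x :: "real ^ ('v::finite set)"
  assumes "fractional_2_matching x"
    and F: "\<And>v. v \<in> U \<Longrightarrow> {v, \<sigma> v} \<in> fractional_edges x" "\<And>v. v \<in> U \<Longrightarrow> \<sigma> v \<in> U"
    and ne: "\<And>v. v \<in> U \<Longrightarrow> \<sigma> v \<noteq> v" "\<And>v. v \<in> U \<Longrightarrow> \<sigma> (\<sigma> v) \<noteq> v"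
    and v: "v \<in> U" "0 < n" "(\<sigma> ^^ n) v = v" "inj_on (\<lambda>i. (\<sigma> ^^ i) v) {..<n}"
  shows "odd n"
proof
  assume ev: "even n"
  define p where "p i = (\<sigma> ^^ i) v" for i
  have pS: "\<sigma> (p i) = p (Suc i)" for i by (simp add: p_def)
  have pU: "p i \<in> U" for i unfolding p_def using v(1) F(2) by (induction i) auto
  let ?e = "\<lambda>i. {p i, p (Suc i)}"
  define d :: "real ^ ('v set)" where "d = (\<chi> e. \<Sum>i<n. if e = ?e i then (- 1) ^ i else 0)"
  have eF: "?e i \<in> fractional_edges x" for i using F(1)[OF pU[of i]] pS[of i] by simp
  have pne: "p i \<noteq> p (Suc i)" for i using ne(1)[OF pU[of i]] pS[of i] by simp
  have "d = 0"
  proof (rule extreme_point_rigid[OF assms(1)])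
    fix e assume "e \<notin> fractional_edges x"
    then have "e \<noteq> ?e i" for i using eF by metis
    then show "d $ e = 0" by (simp add: d_def)
  next
    fix j
    \<comment> \<open>Step \<open>i\<close> adds \<open>(-1) ^ i\<close> at both of its ends; at the
      second end this is the negative of the sign of position \<open>Suc i\<close>. Hence the total
      at \<open>j\<close> telescopes, and it vanishes because \<open>n\<close> is even.\<close>
    define g :: "nat \<Rightarrow> real" where "g i = (if j = p i then (- 1) ^ i else 0)" for i
    have "(\<Sum>e\<in>incident_edges j. d $ e) = (\<Sum>i<n. \<Sum>e\<in>incident_edges j. if e = ?e i then (- 1) ^ i else 0)"
    proof -
      have "(\<Sum>e\<in>incident_edges j. d $ e) = (\<Sum>e\<in>incident_edges j. \<Sum>i<n. if e = ?e i then (- 1) ^ i else 0)"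
        by (intro sum.cong) (simp_all add: d_def)
      then show ?thesis by (simp only: sum.swap[of _ "{..<n}"])
    qed
    also have "\<dots> = (\<Sum>i<n. g i - g (Suc i))"
    proof (rule sum.cong)
      fix i
      have "?e i \<in> incident_edges j \<longleftrightarrow> j = p i \<or> j = p (Suc i)"
        using eF[of i] by (auto simp: incident_edges_def fractional_edges_def)
      then show "(\<Sum>e\<in>incident_edges j. if e = ?e i then (- 1) ^ i else 0) = g i - g (Suc i)"
        using pne[of i] by (auto simp: g_def)
    qed simp
    also have "\<dots> = g 0 - g n" by (rule sum_lessThan_telescope')
    also have "\<dots> = 0" using v(3) ev by (simp add: g_def p_def)
    finally show "(\<Sum>e\<in>incident_edges j. d $ e) = 0" .
  qed
  moreover have "d $ (?e 0) = 1"
  proof -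
    \<comment> \<open>No later step repeats the initial edge: traversing it backwards would give
      \<open>\<sigma> (\<sigma> (p i)) = p i\<close>.\<close>
    have "?e 0 = ?e i \<longleftrightarrow> i = 0" if "i < n" for i
    proof
      assume "?e 0 = ?e i"
      then have "p 0 = p i \<or> p 0 = p (Suc i) \<and> p (Suc 0) = p i" by (auto simp: doubleton_eq_iff)
      then have "p 0 = p i" using ne(2)[OF pU[of i]] pS[of i] pS[of 0] pS[of "Suc i"] ne(2)[OF pU[of 0]] by metis
      then show "i = 0" using v(2,4) that by (auto simp: inj_on_def p_def)
    qed simp
    then have "d $ (?e 0) = (\<Sum>i<n. if i = 0 then (- 1) ^ i else 0)"
      unfolding d_def by (simp only: vec_lambda_beta) (intro sum.cong, auto)
    also have "\<dots> = 1" using v(2) by simp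
    finally show ?thesis .
  qed
  ultimately show False by simp
qed

theorem theorem3:
  fixes c :: "'v::finite set \<Rightarrow> real"
    and x :: "real ^ ('v set)"
  assumes "CARD('v) \<ge> 3"
    and "\<And>e. e \<in> complete_edges \<Longrightarrow> c e \<in> {1, 2}"
    and "fractional_2_matching x"
    and "connected_graph (support_edges x)"
  shows "\<exists>T. tour T \<and>
           (\<Sum>e\<in>T. c e) \<le> 7 / 6 * (\<Sum>e\<in>complete_edges. c e * x $ e)"
proof -
  let ?H = "fractional_edges x" and ?E = "full_edges x"
  define U where "U = {v. valency ?H v \<noteq> 0}"
  have xP: "x \<in> two_matching_polytope"
    using assms(3) by (simp add: fractional_2_matching_def extreme_point_of_def)
  have half: "x $ e = 1 / 2" if "e \<in> ?H" for e using fractional_half[OF assms(3) that] .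
  have cards: "card e = 2" if "e \<in> ?H \<or> e \<in> ?E" for e
    using that by (auto simp: fractional_edges_def full_edges_def complete_edges_def)
  have H_val: "valency ?H v = (if v \<in> U then 2 else 0)" for v
    using valency_fractional[OF assms(3), of v] by (auto simp: U_def)
  have E_val: "valency ?E v = (if v \<in> U then 1 else 2)" for v
  proof -
    have "(\<Sum>e | e \<in> ?H \<and> v \<in> e. x $ e) = (\<Sum>e | e \<in> ?H \<and> v \<in> e. 1 / 2)"
      using half by (intro sum.cong) auto
    also have "\<dots> = real (valency ?H v) / 2" by (simp add: valency_def)
    finally have "real (valency ?H v) / 2 + real (valency ?E v) = 2"
      using incident_sum[OF xP, of v] by simp
    then show ?thesis using H_val[of v] by (auto split: if_splits)
  qed
  have disj: "?E \<inter> ?H = {}" by (auto simp: fractional_edges_def full_edges_def)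
  have split: "(\<Sum>e\<in>complete_edges. f e * x $ e) = (\<Sum>e\<in>?E. f e) + (\<Sum>e\<in>?H. f e) / 2" for f :: "'v set \<Rightarrow> real"
  proof -
    have "(\<Sum>e\<in>complete_edges. f e * x $ e) = (\<Sum>e\<in>?E \<union> ?H. f e * x $ e)"
    proof (rule sum.mono_neutral_right)
      show "\<forall>e\<in>complete_edges - (?E \<union> ?H). f e * x $ e = 0"
      proof
        fix e assume e: "e \<in> complete_edges - (?E \<union> ?H)"
        then have "0 \<le> x $ e" "x $ e \<le> 1" using xP by (auto simp: two_matching_polytope_def)
        then have "x $ e = 0" using e by (auto simp: fractional_edges_def full_edges_def)
        then show "f e * x $ e = 0" by simp
      qed
    qed (auto simp: fractional_edges_def full_edges_def)
    also have "\<dots> = (\<Sum>e\<in>?E. f e * x $ e) + (\<Sum>e\<in>?H. f e * x $ e)"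
      using disj by (intro sum.union_disjoint) auto
    also have "(\<Sum>e\<in>?E. f e * x $ e) = (\<Sum>e\<in>?E. f e)"
      by (intro sum.cong) (auto simp: full_edges_def)
    also have "(\<Sum>e\<in>?H. f e * x $ e) = (\<Sum>e\<in>?H. f e / 2)"
      using half by (intro sum.cong) auto
    finally show ?thesis by (simp add: sum_divide_distrib)
  qed
  have c: "c e \<in> {1, 2}" if "card e = 2" for e
    using assms(2) that by (simp add: complete_edges_def)
  have supp: "support_edges x = ?E \<union> ?H"
    using xP by (force simp: support_edges_def fractional_edges_def full_edges_def two_matching_polytope_def)
  show ?thesis
  proof (cases "U = {}")
    \<comment> \<open>Without fractional edges, the support is connected and 2-regular, so it
      contains a tour.\<close>
    case True
    have "?H = {}"
    proof (rule ccontr)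
      assume "?H \<noteq> {}"
      then obtain e v where "e \<in> ?H" "v \<in> e" using cards by fastforce
      then have "{e \<in> ?H. v \<in> e} \<noteq> {}" by blast
      then show False using True by (auto simp: U_def valency_def)
    qed
    then have "connected_graph ?E" using assms(4) supp by simp
    then obtain T where T: "tour T" "T \<subseteq> ?E"
      using connected_two_regular_tour[of ?E] cards E_val True by auto
    have pos: "0 \<le> c e" if "e \<in> ?E" for e using c[OF cards] that by fastforce
    then have "(\<Sum>e\<in>T. c e) \<le> (\<Sum>e\<in>?E. c e)" using T(2) by (intro sum_mono2) auto
    moreover have "0 \<le> (\<Sum>e\<in>?E. c e)" using pos by (rule sum_nonneg)
    ultimately have "(\<Sum>e\<in>T. c e) \<le> 7 / 6 * (\<Sum>e\<in>complete_edges. c e * x $ e)"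
      using split[of c] \<open>?H = {}\<close> by simp
    then show ?thesis using T(1) by blast
  next
    case False
    from cyclic_successor_exists[of ?H, folded U_def, OF cards valency_fractional[OF assms(3)]]
    obtain \<sigma> where \<sigma>': "bij_betw \<sigma> U U" "\<forall>v\<in>U. {v, \<sigma> v} \<in> ?H \<and> \<sigma> v \<noteq> v \<and> \<sigma> (\<sigma> v) \<noteq> v"
      "\<forall>e\<in>?H. \<exists>v\<in>U. e = {v, \<sigma> v}" by blast
    then have \<sigma>: "bij_betw \<sigma> U U" "\<And>v. v \<in> U \<Longrightarrow> {v, \<sigma> v} \<in> ?H"
        "\<And>v. v \<in> U \<Longrightarrow> \<sigma> v \<noteq> v" "\<And>v. v \<in> U \<Longrightarrow> \<sigma> (\<sigma> v) \<noteq> v" "\<And>e. e \<in> ?H \<Longrightarrow> \<exists>v\<in>U. e = {v, \<sigma> v}"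
      by simp_all
    have \<sigma>U: "\<sigma> v \<in> U" if "v \<in> U" for v using \<sigma>(1) that by (auto simp: bij_betw_def)
    define M where "M = {e \<in> ?E. c e = 1}"
    define A where "A = {e \<in> ?H. c e = 1}"
    have M_val: "valency M v \<le> valency ?E v" for v
      unfolding valency_def M_def by (intro card_mono) auto
    interpret half_edge_graph M A U
    proof
      show "e \<subseteq> U" if "e \<in> A" for e
        using that \<sigma>(5)[of e] \<sigma>U by (auto simp: A_def)
      show "valency M v \<le> 2" for v using M_val[of v] E_val[of v] by (auto split: if_splits)
      show "valency M v \<le> 1" if "v \<in> U" for v using M_val[of v] E_val[of v] that by simp
    qed (use cards in \<open>auto simp: M_def A_def\<close>)
    obtain N where N: "optimal N" using optimal_exists by blast
    interpret optimal_choice M A U \<sigma> N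
    proof
      show "odd n" if "v \<in> U" "0 < n" "(\<sigma> ^^ n) v = v" "inj_on (\<lambda>i. (\<sigma> ^^ i) v) {..<n}" for v n
        using fractional_cycle_odd[OF assms(3) \<sigma>(2) \<sigma>U \<sigma>(3,4) that] .
      \<comment> \<open>A component of \<open>M\<close> with all valencies 2 avoids \<open>U\<close>
        and contains every support edge at its nodes. By connectivity it would be the whole node
        set, but \<open>U\<close> is nonempty.\<close>
      show "\<exists>u\<in>component M v. valency M u \<noteq> 2" for v
      proof (rule ccontr)
        assume "\<not> ?thesis"
        then have two: "valency M u = 2" if "u \<in> component M v" for u using that by blast
        have noU: "u \<notin> U" if "u \<in> component M v" for u
          using two[OF that] M_val[of u] E_val[of u] by auto
        have closed: "z \<in> component M v" if y: "y \<in> component M v" "{y, z} \<in> support_edges x" for y z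
        proof -
          have "{e \<in> M. y \<in> e} = {e \<in> ?E. y \<in> e}"
            using two[OF y(1)] E_val[of y] noU[OF y(1)]
            by (intro card_subset_eq) (auto simp: valency_def M_def)
          moreover have "{y, z} \<notin> ?H"
          proof
            assume "{y, z} \<in> ?H"
            then have "y \<in> U" using \<sigma>(5)[of "{y, z}"] \<sigma>U by (auto simp: doubleton_eq_iff)
            then show False using noU[OF y(1)] by blast
          qed
          ultimately have "{y, z} \<in> M" using y(2) supp by blast
          then have "component M y = component M z" using linked_edge[of y z M] linked_iff[of M y z] by simp
          then show ?thesis using y(1) by (simp add: mem_component)
        qed
        have "w \<in> component M v" for w
        proof -
          have "(v, w) \<in> {(a, b). {a, b} \<in> support_edges x}\<^sup>*"
            using assms(4) by (simp add: connected_graph_def)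
          then show ?thesis
          proof induction
            case (step y z)
            then show ?case using closed[of y z] by simp
          qed (simp add: mem_component)
        qed
        then show False using noU False by blast
      qed
    qed (use \<sigma> N disj in \<open>auto simp: M_def A_def\<close>)
    have "\<exists>T. tour T \<and> (\<Sum>e\<in>T. c e) \<le> real (CARD('v) + num_components (M \<union> N))"
    proof (rule tour_from_components[OF assms(1)])
      show "c e = 1" if "e \<in> M \<union> N" for e using that NA by (auto simp: M_def A_def)
    qed (use graph_edge[OF adm] graph_valency[OF adm] c in auto)
    then obtain T where T: "tour T" "(\<Sum>e\<in>T. c e) \<le> real (CARD('v) + num_components (M \<union> N))" by blast
    have bound: "real (num_components (M \<union> N)) \<le> 7 / 6 * CARD('v) - card M - real (card U) / 2 +
        7 / 12 * card {v \<in> U. {v, \<sigma> v} \<notin> A}"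
      by (rule optimal_components_bound)
    have walls: "card {v \<in> U. {v, \<sigma> v} \<notin> A} \<le> card (?H - A)"
    proof (rule card_inj_on_le)
      show "inj_on (\<lambda>v. {v, \<sigma> v}) {v \<in> U. {v, \<sigma> v} \<notin> A}" by (auto simp: inj_on_def \<sigma>_edge_inj)
    qed (use \<sigma>(2) in auto)
    have H_U: "card ?H = card U"
    proof -
      have "(\<Sum>v\<in>UNIV. valency ?H v) = 2 * card {e \<in> ?H. e \<subseteq> UNIV}"
        using cards by (intro handshake) auto
      then show ?thesis by (simp add: H_val sum.If_cases)
    qed
    have n: "real (CARD('v)) = card ?E + real (card U) / 2"
    proof -
      have "(\<Sum>v\<in>UNIV. valency ?E v) = 2 * card {e \<in> ?E. e \<subseteq> UNIV}"
        using cards by (intro handshake) auto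
      then have "card U + 2 * card (- U) = 2 * card ?E" by (simp add: E_val sum.If_cases)
      moreover have "card (- U) + card U = CARD('v)"
        using card_Un_disjoint[of "- U" U] by (simp add: Un_commute)
      ultimately show ?thesis by simp
    qed
    have cE: "(\<Sum>e\<in>F. c e) = 2 * real (card F) - card {e \<in> F. c e = 1}"
      if "\<And>e. e \<in> F \<Longrightarrow> card e = 2" for F
    proof -
      have "(\<Sum>e\<in>F. c e) = (\<Sum>e\<in>F. 2 - (if c e = 1 then 1 else 0))"
        using c that by (intro sum.cong) fastforce+
      then show ?thesis by (simp add: sum_subtractf sum.If_cases Int_def)
    qed
    have "(\<Sum>e\<in>complete_edges. c e * x $ e) =
        2 * real (card ?E) - card M + (2 * real (card ?H) - card A) / 2"
      using split[of c] cE[of ?E] cE[of ?H] cards by (simp add: M_def A_def)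
    moreover have "card (?H - A) = real (card ?H) - card A" "card M \<le> card ?E"
      by (auto simp: A_def M_def card_Diff_subset of_nat_diff card_mono)
    \<comment> \<open>After substituting |U| = |?H| and n = |?E| + |U|/2, the two bounds differ by
      (|?E| - |M|)/6 in the right direction; the walls cancel against 7/12 for each half edge of
      cost 2.\<close>
    ultimately have "(\<Sum>e\<in>T. c e) \<le> 7 / 6 * (\<Sum>e\<in>complete_edges. c e * x $ e)"
      using T(2) bound walls H_U n by (simp add: field_simps)
    then show ?thesis using T(1) by blast
  qed
qed

end
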